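(* Let $n\ge 2$, and let $d\ge 4$ be an even number. There exists a form $f\in\mathbb{Q}[x_0,\dots,x_n]$ of degree $d$ with the following properties: (1) $f$ is irreducible over $\mathbb{Q}$, and decomposes into a product of $d$ linear forms over $\mathbb{C}$; (2) $f$ is a sum of two squares in $\mathbb{R}[x_0,\dots,x_n]$; (3) $f$ is not a sum of any number of squares in $\mathbb{Q}[x_0,\dots,x_n]$.
   Context: A form is a homogeneous polynomial. *)

theory Defs
  imports
    Complex_Main
    "HOL-Library.Poly_Mapping"
    "HOL-Computational_Algebra.Computational_Algebra"
begin

text \<open>
  Monomials are finitely supported exponent vectors on the variables $x_0, x_1, x_2, \dots$,
  and polynomials are finitely supported families of coefficients indexed by monomials; the ring
  structure (convolution product) is that of \<^theory>\<open>HOL-Library.Poly_Mapping\<close>.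
\<close>

type_synonym 'a mpoly = "(nat \<Rightarrow>\<^sub>0 nat) \<Rightarrow>\<^sub>0 'a"

text \<open>The subring $R[x_0,\dots,x_n]$, with $n + 1$ variables.\<close>

definition polys :: "nat \<Rightarrow> 'a::zero mpoly set" where
  "polys n = {p. \<forall>m \<in> Poly_Mapping.keys p. Poly_Mapping.keys m \<subseteq> {..n}}"

definition mon_degree :: "(nat \<Rightarrow>\<^sub>0 nat) \<Rightarrow> nat" where
  "mon_degree m = (\<Sum>i \<in> Poly_Mapping.keys m. Poly_Mapping.lookup m i)"

text \<open>As usual, the zero polynomial counts as a form of every degree.\<close>

definition is_form :: "nat \<Rightarrow> 'a::zero mpoly \<Rightarrow> bool" where
  "is_form d p \<longleftrightarrow> (\<forall>m \<in> Poly_Mapping.keys p. mon_degree m = d)"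

text \<open>
  \<^const>\<open>irreducible\<close> refers to a whole type; here factors and inverses are taken in a subring \<open>R\<close>.
\<close>

definition unit_in :: "'a::comm_semiring_1 set \<Rightarrow> 'a \<Rightarrow> bool" where
  "unit_in R u \<longleftrightarrow> u \<in> R \<and> (\<exists>v \<in> R. u * v = 1)"

definition irreducible_in :: "'a::comm_semiring_1 set \<Rightarrow> 'a \<Rightarrow> bool" where
  "irreducible_in R p \<longleftrightarrow> p \<in> R \<and> p \<noteq> 0 \<and> \<not> unit_in R p \<and>
     (\<forall>a \<in> R. \<forall>b \<in> R. p = a * b \<longrightarrow> unit_in R a \<or> unit_in R b)"

lemma unit_in_UNIV: "unit_in UNIV u \<longleftrightarrow> u dvd 1"
  unfolding unit_in_def by (metis UNIV_I dvd_def)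

lemma irreducible_in_UNIV: "irreducible_in UNIV p \<longleftrightarrow> irreducible p"
  by (simp add: irreducible_in_def irreducible_def unit_in_UNIV)

definition sum_of_squares_in :: "'a::comm_semiring_1 set \<Rightarrow> nat \<Rightarrow> 'a \<Rightarrow> bool" where
  "sum_of_squares_in R k p \<longleftrightarrow> (\<exists>g. (\<forall>i<k. g i \<in> R) \<and> p = (\<Sum>i<k. (g i)\<^sup>2))"

text \<open>Base change of a rational polynomial to an extension field of characteristic 0.\<close>

definition base_change :: "rat mpoly \<Rightarrow> 'a::field_char_0 mpoly" where
  "base_change f = Poly_Mapping.map of_rat f"

lemma lookup_base_change:
  "Poly_Mapping.lookup (base_change f) m = of_rat (Poly_Mapping.lookup f m)"
  by (simp add: base_change_def Poly_Mapping.map.rep_eq when_def)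

end

theory Submission
  imports Defs "HOL-Computational_Algebra.Field_as_Ring"
begin

text \<open>
  Let \<open>p\<close> be an irreducible rational polynomial of even degree \<open>d\<close> without real roots, and let
  \<open>f\<close> be the product of the linear forms \<open>x\<^sub>0 + a x\<^sub>1 + a\<^sup>2 x\<^sub>2\<close> over the roots \<open>a\<close> of \<open>p\<close>. This is a
  norm, so it has rational coefficients and is irreducible. The linear forms come in complex
  conjugate pairs, so \<open>f = g g'\<close> with \<open>g'\<close> the conjugate of \<open>g\<close>, the sum of the squares of the real and the
  imaginary part of \<open>g\<close>.

  At the point \<open>(u w, - (u + w), 1)\<close>, where the lines with parameters \<open>u\<close> and \<open>w\<close> meet, \<open>f\<close> takes the
  value \<open>p(u) p(w)\<close>. If \<open>f\<close> is a sum of squares of rational polynomials, every summand thus becomes a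
  polynomial \<open>H(u, w)\<close> over \<open>\<rat>\<close> of degree at most \<open>d / 2\<close> in \<open>w\<close>. Conjugate roots \<open>a\<close>, \<open>b\<close> give a real point
  at which \<open>f\<close> is zero, so \<open>H(a, b) = 0\<close>. If \<open>b\<close> has degree more than \<open>d / 2\<close> over \<open>\<rat>(a)\<close>, it follows
  that \<open>H(a, w) = 0\<close> identically, so \<open>p(u)\<close> divides every \<open>H(u, w)\<close>, and \<open>p(u)\<^sup>2\<close> divides
  \<open>p(u) p(w)\<close>, which is absurd (lemma \<open>norm_form_not_sum_of_squares\<close>).

  It remains to find \<open>p\<close> with a root whose conjugate has large degree over it. The choice is
  \<open>p = y\<^sup>d + y\<^sup>d\<^sup>-\<^sup>1 + 2 y\<^sup>d\<^sup>-\<^sup>2 + 2 = y\<^sup>d\<^sup>-\<^sup>2 (y\<^sup>2 + y + 2) + 2\<close>, which is positive on the real line. For an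
  extension of the 2-adic valuation to \<open>\<complex>\<close>, normalized so that 2 has valuation 1, exactly one root \<open>a\<close> is a unit, and all others
  have valuation \<open>1 / (d - 1)\<close>. In particular the complex conjugate \<open>b\<close> of \<open>a\<close> has this valuation. By
  Hensel's lemma \<open>\<rat>(a)\<close> embeds into the 2-adic numbers, so its nonzero elements have integral valuations.
  The terms of a relation of degree less than \<open>d - 1\<close> for \<open>b\<close> over \<open>\<rat>(a)\<close> therefore have distinct valuations
  and cannot cancel (lemma \<open>ramified_independent\<close>). With coefficients in \<open>\<rat>\<close> the same
  argument shows that \<open>p\<close> is irreducible: a factor vanishing at \<open>b\<close> has degree at least \<open>d - 1\<close>, and the
  cofactor cannot be linear, as \<open>p\<close> has no rational root.
\<close>

section \<open>Valuation rings\<close>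

definition is_subring :: "'a::comm_ring_1 set \<Rightarrow> bool" where
  "is_subring A \<longleftrightarrow> 1 \<in> A \<and> (\<forall>x\<in>A. \<forall>y\<in>A. x - y \<in> A \<and> x * y \<in> A)"

context
  fixes A :: "'a::comm_ring_1 set"
  assumes A: "is_subring A"
begin

lemma subring_one: "1 \<in> A"
  using A by (simp add: is_subring_def)

lemma subring_diff: "x \<in> A \<Longrightarrow> y \<in> A \<Longrightarrow> x - y \<in> A"
  using A by (simp add: is_subring_def)

lemma subring_mult: "x \<in> A \<Longrightarrow> y \<in> A \<Longrightarrow> x * y \<in> A"
  using A by (simp add: is_subring_def)

lemma subring_zero: "0 \<in> A"
  using subring_diff[OF subring_one subring_one] by simp

lemma subring_uminus: "x \<in> A \<Longrightarrow> - x \<in> A"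
  using subring_diff[OF subring_zero] by simp

lemma subring_add: "x \<in> A \<Longrightarrow> y \<in> A \<Longrightarrow> x + y \<in> A"
  using subring_diff[of x "- y"] subring_uminus by simp

lemma subring_sum: "(\<And>i. i \<in> I \<Longrightarrow> g i \<in> A) \<Longrightarrow> sum g I \<in> A"
  by (induction I rule: infinite_finite_induct) (auto simp: subring_zero subring_add)

lemma subring_prod: "(\<And>i. i \<in> I \<Longrightarrow> g i \<in> A) \<Longrightarrow> prod g I \<in> A"
  by (induction I rule: infinite_finite_induct) (auto simp: subring_one subring_mult)

lemma subring_power: "x \<in> A \<Longrightarrow> x ^ n \<in> A"
  by (induction n) (auto simp: subring_one subring_mult)

lemma subring_of_nat: "of_nat n \<in> A"
  by (induction n) (auto simp: subring_zero subring_one subring_add)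

lemma subring_of_int: "of_int n \<in> A"
  by (cases n rule: int_cases2) (auto simp: subring_of_nat subring_uminus)

lemma subring_numeral: "numeral n \<in> A"
  using subring_of_nat[of "numeral n"] by simp

lemma subring_poly: "(\<And>i. coeff q i \<in> A) \<Longrightarrow> x \<in> A \<Longrightarrow> poly q x \<in> A"
  unfolding poly_altdef by (intro subring_sum subring_mult subring_power)

end

lemmas subring_intros = subring_one subring_diff subring_mult subring_zero subring_uminus
  subring_add subring_sum subring_prod subring_power subring_of_nat subring_of_int subring_numeral

lemma poly_eq_sum_upto:
  fixes q :: "'a::comm_ring_1 poly"
  assumes "degree q \<le> n"
  shows "poly q x = (\<Sum>i\<le>n. coeff q i * x ^ i)"
  unfolding poly_altdef using assms
  by (intro sum.mono_neutral_left) (auto simp: coeff_eq_0 not_le)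

definition adjoin :: "'a::comm_ring_1 set \<Rightarrow> 'a \<Rightarrow> 'a set" where
  "adjoin A x = {poly q x | q. \<forall>i. coeff q i \<in> A}"

lemma is_subring_adjoin:
  assumes A: "is_subring A"
  shows "is_subring (adjoin A x)"
  unfolding is_subring_def
proof (intro conjI ballI)
  show "1 \<in> adjoin A x"
    unfolding adjoin_def
    by (intro CollectI exI[of _ 1]) (auto simp: coeff_1 subring_zero[OF A] subring_one[OF A])
next
  fix y z assume "y \<in> adjoin A x" "z \<in> adjoin A x"
  then obtain q r where q: "y = poly q x" "\<And>i. coeff q i \<in> A"
    and r: "z = poly r x" "\<And>i. coeff r i \<in> A"
    by (auto simp: adjoin_def)
  show "y - z \<in> adjoin A x"
    unfolding adjoin_def using q r by (intro CollectI exI[of _ "q - r"]) (auto intro: subring_diff[OF A])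
  show "y * z \<in> adjoin A x"
    unfolding adjoin_def using q r
    by (intro CollectI exI[of _ "q * r"]) (auto simp: coeff_mult intro!: subring_sum[OF A] subring_mult[OF A])
qed

lemma adjoin_superset: "is_subring A \<Longrightarrow> A \<subseteq> adjoin A x"
proof
  fix a assume "is_subring A" "a \<in> A"
  then show "a \<in> adjoin A x"
    unfolding adjoin_def
    by (intro CollectI exI[of _ "[:a:]"]) (auto simp: coeff_pCons subring_zero split: nat.splits)
qed

lemma adjoin_self: "is_subring A \<Longrightarrow> x \<in> adjoin A x"
  unfolding adjoin_def
  by (intro CollectI exI[of _ "[:0, 1:]"])
     (auto simp: coeff_pCons subring_zero subring_one split: nat.splits)

text \<open>
  The aim is that \<open>M\<close> contains \<open>x\<close> or \<open>1/x\<close> for every \<open>x\<close>. The argument is the usual one for the existence of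
  valuation rings, with \<open>t M\<close> in place of the maximal ideal of \<open>M\<close>.
\<close>

context
  fixes M :: "'a::field set" and t :: 'a
  assumes M: "is_subring M" and t: "t \<in> M" "t \<noteq> 0" "inverse t \<notin> M"
    and max: "\<And>B. is_subring B \<Longrightarrow> M \<subseteq> B \<Longrightarrow> inverse t \<notin> B \<Longrightarrow> B = M"
begin

lemma maximal_adjoin: "x \<notin> M \<Longrightarrow> inverse t \<in> adjoin M x"
  using max[of "adjoin M x"] is_subring_adjoin[OF M] adjoin_superset[OF M] adjoin_self[OF M] by blast

text \<open>
  The powers of \<open>z = 1 - t y\<close> are congruent to 1 modulo \<open>t M\<close>. If \<open>1/t\<close> were a polynomial in \<open>1/z\<close>, then
  multiplying by a power of \<open>z\<close> would give \<open>1 \<in> t M\<close>.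
\<close>

lemma maximal_unit:
  assumes y: "y \<in> M"
  shows "1 - t * y \<noteq> 0" "inverse (1 - t * y) \<in> M"
proof -
  define z where "z = 1 - t * y"
  have zM: "z \<in> M" unfolding z_def by (intro subring_intros[OF M] t y)
  show nz: "1 - t * y \<noteq> 0"
  proof
    assume "1 - t * y = 0"
    hence "inverse t = y" using t by (simp add: field_simps)
    thus False using y t by simp
  qed
  show "inverse (1 - t * y) \<in> M"
  proof (rule ccontr)
    assume "inverse (1 - t * y) \<notin> M"
    then obtain q where q: "inverse t = poly q (inverse z)" "\<And>i. coeff q i \<in> M"
      using maximal_adjoin[of "inverse z"] by (auto simp: adjoin_def z_def)
    define n where "n = degree q"
    have "\<exists>e\<in>M. z ^ n = 1 + t * e" for n
    proof (induction n)
      case 0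
      then show ?case by (intro bexI[of _ 0]) (auto simp: subring_zero[OF M])
    next
      case (Suc n)
      then obtain e where e: "e \<in> M" "z ^ n = 1 + t * e" by blast
      have "z ^ Suc n = 1 + t * (e - y - t * y * e)"
        by (simp add: e(2)) (simp add: z_def algebra_simps)
      then show ?case using e(1) by (intro bexI[of _ "e - y - t * y * e"]) (auto intro!: subring_intros[OF M] t y)
    qed
    then obtain e where e: "e \<in> M" "z ^ n = 1 + t * e" by blast
    define c where "c = (\<Sum>i\<le>n. coeff q i * z ^ (n - i))"
    have cM: "c \<in> M" unfolding c_def by (intro subring_intros[OF M] q zM)
    have "z ^ n * inverse t = c"
      unfolding q(1) poly_altdef c_def n_def[symmetric] sum_distrib_left
    proof (intro sum.cong refl)
      fix i assume "i \<in> {..n}"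
      hence "z ^ n = z ^ (n - i) * z ^ i" by (simp flip: power_add)
      then show "z ^ n * (coeff q i * inverse z ^ i) = coeff q i * z ^ (n - i)"
        using nz by (simp add: z_def[symmetric] power_inverse field_simps)
    qed
    hence "inverse t = c - e" using t by (simp add: e(2) field_simps)
    with cM e(1) t show False by (auto intro!: subring_diff[OF M])
  qed
qed

text \<open>
  If neither \<open>x\<close> nor \<open>1/x\<close> were in \<open>M\<close>, both would satisfy such relations, by maximality. Two relations
  of least degree then contradict each other.
\<close>

definition small_relation :: "'a \<Rightarrow> nat \<Rightarrow> 'a poly \<Rightarrow> bool" where
  "small_relation x n q \<longleftrightarrow> degree q \<le> n \<and> (\<forall>i. \<exists>y\<in>M. coeff q i = t * y) \<and> poly q x = 1"

lemma small_relation_exists: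
  assumes "x \<notin> M"
  shows "\<exists>n q. small_relation x n q"
proof -
  obtain q where q: "inverse t = poly q x" "\<And>i. coeff q i \<in> M"
    using maximal_adjoin[OF assms] by (auto simp: adjoin_def)
  have "small_relation x (degree q) (smult t q)"
    unfolding small_relation_def using q t by (auto simp flip: q(1))
  thus ?thesis by blast
qed

text \<open>
  The relation for \<open>1/x\<close>, of degree \<open>m \<le> n\<close>, expresses \<open>x ^ m\<close> by lower powers of \<open>x\<close>, because
  \<open>1\<close> minus its constant coefficient is a unit. This lowers the degree of the relation for \<open>x\<close>.
\<close>

lemma small_relation_reduce:
  assumes x: "x \<noteq> 0" and q: "small_relation x n q" and r: "small_relation (inverse x) m r"
    and mn: "m \<le> n"
  shows "n > 0 \<and> (\<exists>q'. small_relation x (n - 1) q')"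
proof -
  from q obtain a where a: "\<And>i. a i \<in> M" "\<And>i. coeff q i = t * a i"
    unfolding small_relation_def by metis
  from r obtain b where b: "\<And>i. b i \<in> M" "\<And>i. coeff r i = t * b i"
    unfolding small_relation_def by metis
  have dq: "degree q \<le> n" "poly q x = 1" and dr: "degree r \<le> m" "poly r (inverse x) = 1"
    using q r by (auto simp: small_relation_def)
  define u where "u = inverse (1 - t * b 0)"
  have u: "u \<in> M" "u * (1 - t * b 0) = 1"
    using maximal_unit[OF b(1)[of 0]] by (auto simp: u_def)
  have "1 = (\<Sum>i\<le>m. coeff r i * inverse x ^ i)"
    using dr poly_eq_sum_upto[OF dr(1), of "inverse x"] by simp
  also have "\<dots> = t * b 0 + (\<Sum>i\<in>{1..m}. t * b i * inverse x ^ i)"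
    by (simp add: b(2) atMost_atLeast0 sum.atLeast_Suc_atMost)
  finally have "1 - t * b 0 = (\<Sum>i\<in>{1..m}. t * b i * inverse x ^ i)"
    by (metis add_diff_cancel_left')
  hence "u * (1 - t * b 0) = u * (\<Sum>i\<in>{1..m}. t * b i * inverse x ^ i)" by (rule arg_cong)
  hence one: "1 = u * (\<Sum>i\<in>{1..m}. t * b i * inverse x ^ i)" using u by simp
  hence m0: "m > 0" by (cases m) auto
  define s where "s = (\<Sum>i\<in>{1..m}. monom (t * (u * b i)) (m - i))"
  have ps: "poly s x = x ^ m"
  proof -
    have "poly s x = (\<Sum>i\<in>{1..m}. x ^ m * (u * (t * b i * inverse x ^ i)))"
      unfolding s_def poly_sum
    proof (intro sum.cong refl)
      fix i assume "i \<in> {1..m}"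
      hence "x ^ m = x ^ (m - i) * x ^ i" by (simp flip: power_add)
      then show "poly (monom (t * (u * b i)) (m - i)) x = x ^ m * (u * (t * b i * inverse x ^ i))"
        using x by (simp add: poly_monom power_inverse field_simps)
    qed
    also have "\<dots> = x ^ m * (u * (\<Sum>i\<in>{1..m}. t * b i * inverse x ^ i))"
      by (simp add: sum_distrib_left)
    finally show ?thesis using one by simp
  qed
  define tM where "tM = {t * y | y. y \<in> M}"
  have tM0: "0 \<in> tM" unfolding tM_def using subring_zero[OF M] by force
  have tMadd: "v + w \<in> tM" if "v \<in> tM" "w \<in> tM" for v w
    using that unfolding tM_def by (auto simp flip: distrib_left intro: subring_add[OF M])
  have tMsum: "sum g I \<in> tM" if "\<And>i. i \<in> I \<Longrightarrow> g i \<in> tM" for g :: "nat \<Rightarrow> 'a" and I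
    using that by (induction I rule: infinite_finite_induct) (auto intro: tM0 tMadd)
  have tMmult: "v * w \<in> tM" if "v \<in> M" "w \<in> tM" for v w
  proof -
    from that obtain y where "y \<in> M" "v * w = t * (v * y)" by (auto simp: tM_def mult_ac)
    thus ?thesis using that subring_mult[OF M] unfolding tM_def by blast
  qed
  have cs: "coeff s i \<in> tM" for i
    unfolding s_def coeff_sum
    by (intro tMsum) (auto intro!: tM0, auto simp: tM_def intro!: exI u b subring_mult[OF M])
  have ds: "degree s \<le> m - 1"
    unfolding s_def by (intro degree_sum_le) (auto intro: order.trans[OF degree_monom_le])
  define q' where "q' = q - monom (coeff q n) n + monom (coeff q n) (n - m) * s"
  have "poly q' x = 1"
  proof -
    have "poly q' x = 1 - coeff q n * x ^ n + coeff q n * (x ^ (n - m) * x ^ m)"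
      by (simp add: q'_def dq poly_monom ps)
    thus ?thesis using mn by (simp flip: power_add)
  qed
  moreover have "degree q' \<le> n - 1"
  proof (rule degree_le, safe)
    fix i assume i: "n - 1 < i"
    have "degree (monom (coeff q n) (n - m) * s) \<le> n - 1"
      using degree_mult_le[of "monom (coeff q n) (n - m)" s] degree_monom_le[of "coeff q n" "n - m"] ds m0 mn
      by linarith
    hence "coeff (monom (coeff q n) (n - m) * s) i = 0" using i by (intro coeff_eq_0) auto
    moreover have "coeff (q - monom (coeff q n) n) i = 0"
      using i dq(1) by (cases "i = n") (auto intro: coeff_eq_0)
    ultimately show "coeff q' i = 0" by (simp add: q'_def)
  qed
  moreover have "coeff q' i \<in> tM" for i
  proof -
    have "coeff (q - monom (coeff q n) n) i \<in> tM"
      using tM0 a by (auto simp: tM_def)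
    moreover have "coeff (monom (coeff q n) (n - m) * s) i \<in> tM"
      unfolding coeff_mult
      by (intro tMsum tMmult cs) (auto simp: a intro: subring_intros[OF M] t)
    ultimately show ?thesis unfolding q'_def coeff_add by (rule tMadd)
  qed
  ultimately have "small_relation x (n - 1) q'" by (auto simp: small_relation_def tM_def)
  thus ?thesis using m0 mn by auto
qed

lemma small_relations_incompatible:
  assumes "x \<noteq> 0" "small_relation x n q" "small_relation (inverse x) m r"
  shows False
  using assms
proof (induction "n + m" arbitrary: n m q r rule: less_induct)
  case less
  show ?case
  proof (cases "m \<le> n")
    case True
    from small_relation_reduce[OF less.prems(1,2,3) True] obtain q' where
      "n > 0" "small_relation x (n - 1) q'" by blast
    then show False using less.hyps[of "n - 1" m q' r] less.prems by simp
  next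
    case False
    from small_relation_reduce[of "inverse x" m r n q] False less.prems obtain r' where
      "m > 0" "small_relation (inverse x) (m - 1) r'" by auto
    then show False using less.hyps[of n "m - 1" q r'] less.prems by simp
  qed
qed

lemma maximal_valuation: "x \<in> M \<or> inverse x \<in> M"
proof (cases "x = 0")
  case True
  then show ?thesis using subring_zero[OF M] by simp
next
  case False
  then show ?thesis
    using small_relation_exists[of x] small_relation_exists[of "inverse x"]
      small_relations_incompatible by blast
qed

end

text \<open>
  The subrings between \<open>A\<close> and the field that avoid \<open>1/t\<close> are closed under unions of chains, so
  Zorn's lemma gives a maximal one.
\<close>

theorem valuation_ring_exists:
  fixes A :: "'a::field set"
  assumes A: "is_subring A" and t: "t \<in> A" "t \<noteq> 0" "inverse t \<notin> A"
  obtains V where "is_subring V" "A \<subseteq> V" "inverse t \<notin> V" "\<And>x. x \<in> V \<or> inverse x \<in> V"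
proof -
  define F where "F = {B. is_subring B \<and> A \<subseteq> B \<and> inverse t \<notin> B}"
  have "\<exists>M\<in>F. \<forall>X\<in>F. M \<subseteq> X \<longrightarrow> X = M"
  proof (rule subset_Zorn_nonempty)
    show "F \<noteq> {}" using A t by (auto simp: F_def)
  next
    fix C assume C: "C \<noteq> {}" "subset.chain F C"
    have sub: "is_subring B" "A \<subseteq> B" "inverse t \<notin> B" if "B \<in> C" for B
      using C that by (auto simp: subset.chain_def F_def)
    have "is_subring (\<Union>C)"
      unfolding is_subring_def
    proof (intro conjI ballI)
      show "1 \<in> \<Union>C" using C(1) sub(1) subring_one by blast
    next
      fix x y assume "x \<in> \<Union>C" "y \<in> \<Union>C"
      then obtain X Y where XY: "x \<in> X" "X \<in> C" "y \<in> Y" "Y \<in> C" by blast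
      with C(2) have "X \<subseteq> Y \<or> Y \<subseteq> X" by (auto simp: subset.chain_def)
      with XY obtain Z where "x \<in> Z" "y \<in> Z" "Z \<in> C" by blast
      then show "x - y \<in> \<Union>C" "x * y \<in> \<Union>C"
        using subring_diff[OF sub(1)] subring_mult[OF sub(1)] by blast+
    qed
    moreover have "A \<subseteq> \<Union>C" using C(1) sub(2) by blast
    ultimately show "\<Union>C \<in> F" using sub(3) by (auto simp: F_def)
  qed
  then obtain V where V: "V \<in> F" "\<And>X. X \<in> F \<Longrightarrow> V \<subseteq> X \<Longrightarrow> X = V" by blast
  show thesis
  proof (rule that)
    show VV: "is_subring V" "A \<subseteq> V" "inverse t \<notin> V" using V(1) by (auto simp: F_def)
    show "x \<in> V \<or> inverse x \<in> V" for x
    proof (rule maximal_valuation[OF VV(1) _ t(2) VV(3)])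
      show "t \<in> V" using VV t by blast
      show "B = V" if "is_subring B" "V \<subseteq> B" "inverse t \<notin> B" for B
        using that VV V(2)[of B] by (auto simp: F_def)
    qed
  qed
qed

section \<open>Units and nonunits of a valuation ring above 2\<close>

text \<open>
  The valuation itself does not occur: units are the elements of valuation zero, and nonunits are those of
  positive valuation. Together with powers of 2 and of a single further element this expresses all
  comparisons of valuations below.
\<close>

locale valuation_over_2 =
  fixes V :: "'a::field_char_0 set"
  assumes subring: "is_subring V"
    and total: "\<And>x. x \<in> V \<or> inverse x \<in> V"
    and half: "inverse 2 \<notin> V"
begin

definition unit :: "'a \<Rightarrow> bool" where
  "unit x \<longleftrightarrow> x \<in> V \<and> x \<noteq> 0 \<and> inverse x \<in> V"

definition nonunit :: "'a \<Rightarrow> bool" where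
  "nonunit x \<longleftrightarrow> x \<in> V \<and> (x = 0 \<or> inverse x \<notin> V)"

lemmas V_intros = subring_intros[OF subring]

lemma in_V: "unit x \<Longrightarrow> x \<in> V" "nonunit x \<Longrightarrow> x \<in> V"
  by (auto simp: unit_def nonunit_def)

lemma unit_nonzero: "unit x \<Longrightarrow> x \<noteq> 0"
  by (auto simp: unit_def)

lemma unit_or_nonunit: "x \<in> V \<Longrightarrow> unit x \<or> nonunit x"
  by (auto simp: unit_def nonunit_def)

lemma not_unit_nonunit: "unit x \<Longrightarrow> nonunit x \<Longrightarrow> False"
  by (auto simp: unit_def nonunit_def)

lemma unit_1 [simp]: "unit 1"
  by (auto simp: unit_def intro: V_intros)

lemma nonunit_0 [simp]: "nonunit 0"
  by (auto simp: nonunit_def intro: V_intros)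

lemma not_nonunit_1: "\<not> nonunit 1"
  using not_unit_nonunit[OF unit_1] by blast

lemma nonunit_2: "nonunit 2"
  using half by (auto simp: nonunit_def intro: V_intros)

lemma unit_inverse: "unit x \<Longrightarrow> unit (inverse x)"
  by (auto simp: unit_def)

lemma unit_mult: "unit x \<Longrightarrow> unit y \<Longrightarrow> unit (x * y)"
  by (auto simp: unit_def intro: V_intros)

lemma unit_divide: "unit x \<Longrightarrow> unit y \<Longrightarrow> unit (x / y)"
  using unit_mult[OF _ unit_inverse] by (simp add: field_simps)

lemma unit_uminus: "unit x \<Longrightarrow> unit (- x)"
  by (auto simp: unit_def intro: V_intros)

lemma unit_power: "unit x \<Longrightarrow> unit (x ^ n)"
  by (induction n) (auto intro: unit_mult)

lemma unit_powi: "unit x \<Longrightarrow> unit (x powi k)"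
  by (auto simp: power_int_def intro: unit_power unit_inverse)

lemma nonunit_mult:
  assumes "nonunit x" "y \<in> V"
  shows "nonunit (x * y)"
proof -
  have "x * y \<in> V" using assms in_V by (auto intro: V_intros)
  moreover have False if "unit (x * y)"
  proof -
    from that have "inverse (x * y) * y \<in> V" "x \<noteq> 0" "y \<noteq> 0"
      using assms by (auto simp: unit_def intro: V_intros)
    thus False using assms by (simp add: nonunit_def field_simps)
  qed
  ultimately show ?thesis using unit_or_nonunit by blast
qed

lemma nonunit_uminus: "nonunit x \<Longrightarrow> nonunit (- x)"
  using nonunit_mult[of x "-1"] V_intros by simp

text \<open>
  Of two nonzero elements one divides the other in \<open>V\<close>, which makes the nonunits an ideal.
\<close>

lemma nonunit_add_aux:
  assumes "nonunit x" "nonunit y" "y \<noteq> 0" "x / y \<in> V"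
  shows "nonunit (x + y)"
proof -
  have "nonunit (y * (1 + x / y))" using assms by (intro nonunit_mult) (auto intro: V_intros)
  moreover have "y * (1 + x / y) = x + y" using assms(3) by (simp add: distrib_left)
  ultimately show ?thesis by simp
qed

lemma nonunit_add:
  assumes "nonunit x" "nonunit y"
  shows "nonunit (x + y)"
proof (cases "x = 0 \<or> y = 0")
  case False
  then show ?thesis
    using nonunit_add_aux[of x y] nonunit_add_aux[of y x] assms total[of "x / y"] by (auto simp: add.commute)
qed (use assms in auto)

lemma nonunit_diff: "nonunit x \<Longrightarrow> nonunit y \<Longrightarrow> nonunit (x - y)"
  using nonunit_add[of x "- y"] nonunit_uminus[of y] by simp

lemma nonunit_sum: "(\<And>i. i \<in> I \<Longrightarrow> nonunit (g i)) \<Longrightarrow> nonunit (sum g I)"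
  by (induction I rule: infinite_finite_induct) (auto intro: nonunit_add)

lemma unit_add_nonunit:
  assumes "unit x" "nonunit y"
  shows "unit (x + y)"
proof (rule ccontr)
  assume "\<not> unit (x + y)"
  hence "nonunit (x + y)" using unit_or_nonunit[of "x + y"] assms in_V by (auto intro: V_intros)
  from nonunit_diff[OF this assms(2)] show False using assms(1) not_unit_nonunit by auto
qed

lemma unit_congruent: "nonunit (x - y) \<Longrightarrow> unit y \<Longrightarrow> unit x"
  using unit_add_nonunit[of y "x - y"] by simp

lemma nonunit_factor: "x \<in> V \<Longrightarrow> y \<in> V \<Longrightarrow> nonunit (x * y) \<Longrightarrow> nonunit x \<or> nonunit y"
  using unit_or_nonunit unit_mult not_unit_nonunit by blast

lemma nonunit_prod_factor:
  "finite I \<Longrightarrow> nonunit (prod g I) \<Longrightarrow> (\<And>i. i \<in> I \<Longrightarrow> g i \<in> V) \<Longrightarrow> \<exists>i\<in>I. nonunit (g i)"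
proof (induction I rule: finite_induct)
  case (insert i I)
  then show ?case using nonunit_factor[of "g i" "prod g I"] by (auto intro: V_intros)
qed (use not_nonunit_1 in auto)

lemma nonunit_power: "nonunit x \<Longrightarrow> n > 0 \<Longrightarrow> nonunit (x ^ n)"
  by (cases n) (simp_all add: nonunit_mult in_V(2) subring_power[OF subring])

lemma nonunit_even: "nonunit (of_int (2 * n))"
  using nonunit_mult[OF nonunit_2, of "of_int n"] by (auto intro: V_intros)

lemma unit_odd:
  assumes "odd n"
  shows "unit (of_int n)"
proof -
  from assms obtain k where k: "n = 2 * k + 1" by (rule oddE)
  have "unit (1 + of_int (2 * k))" by (intro unit_add_nonunit nonunit_even) simp
  thus ?thesis by (simp add: k add.commute)
qed

subsection \<open>Elements that are a power of 2 times a unit\<close>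

text \<open>These are the nonzero elements whose valuation is an integral multiple of that of 2.\<close>

definition dyadic :: "'a \<Rightarrow> bool" where
  "dyadic x \<longleftrightarrow> (\<exists>k u. unit u \<and> x = 2 powi k * u)"

lemma dyadic_mult: "dyadic x \<Longrightarrow> dyadic y \<Longrightarrow> dyadic (x * y)"
proof -
  assume "dyadic x" "dyadic y"
  then obtain k u l v where "unit u" "x = 2 powi k * u" "unit v" "y = 2 powi l * v"
    by (auto simp: dyadic_def)
  then show ?thesis
    unfolding dyadic_def
    by (intro exI[of _ "k + l"] exI[of _ "u * v"]) (auto simp: power_int_add intro: unit_mult)
qed

lemma dyadic_inverse: "dyadic x \<Longrightarrow> dyadic (inverse x)"
proof -
  assume "dyadic x"
  then obtain k u where "unit u" "x = 2 powi k * u"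
    by (auto simp: dyadic_def)
  then show ?thesis
    unfolding dyadic_def
    by (intro exI[of _ "- k"] exI[of _ "inverse u"])
       (auto simp: power_int_minus intro: unit_inverse)
qed

lemma dyadic_unit: "unit x \<Longrightarrow> dyadic x"
  unfolding dyadic_def by (intro exI[of _ 0] exI[of _ x]) auto

lemma dyadic_2: "dyadic 2"
  unfolding dyadic_def by (intro exI[of _ 1] exI[of _ 1]) auto

lemma dyadic_of_nat: "n > 0 \<Longrightarrow> dyadic (of_nat n)"
proof (induction n rule: less_induct)
  case (less n)
  show ?case
  proof (cases "even n")
    case True
    then obtain m where m: "n = 2 * m" by (rule evenE)
    then show ?thesis using less dyadic_mult[OF dyadic_2, of "of_nat m"] by simp
  next
    case False
    then show ?thesis using unit_odd[of "int n"] by (auto intro: dyadic_unit)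
  qed
qed

lemma dyadic_of_int: "n \<noteq> 0 \<Longrightarrow> dyadic (of_int n)"
proof (cases n rule: int_cases2)
  case (nonpos m)
  assume "n \<noteq> 0"
  then show ?thesis
    using nonpos dyadic_mult[OF dyadic_unit[OF unit_uminus[OF unit_1]] dyadic_of_nat[of m]] by simp
qed (use dyadic_of_nat in auto)

lemma dyadic_of_rat:
  assumes "r \<noteq> 0"
  shows "dyadic (of_rat r)"
proof (cases r)
  case (Fract a b)
  then have "of_rat r = (of_int a * inverse (of_int b) :: 'a)" "a \<noteq> 0" "b \<noteq> 0"
    using assms by (auto simp: of_rat_rat field_simps rat_number_collapse)
  then show ?thesis using dyadic_mult dyadic_inverse dyadic_of_int by simp
qed

lemma dyadic_cofinal:
  assumes "dyadic x \<or> x = 0"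
  shows "\<exists>k. 2 ^ k * x \<in> V"
proof (cases "x = 0")
  case False
  then obtain k u where x: "unit u" "x = 2 powi k * u" using assms by (auto simp: dyadic_def)
  have "2 ^ nat (- k) * x = 2 ^ nat k * u"
    using x(2) by (auto simp: power_int_def field_simps)
  thus ?thesis using x(1) in_V by (metis V_intros(4) V_intros(10) subring_mult subring_numeral subring_power subring)
qed (auto intro: V_intros)

lemma power_2_mult_mono:
  assumes "2 ^ k * x \<in> V" "k \<le> l"
  shows "2 ^ l * x \<in> V"
proof -
  have "2 ^ l * x = 2 ^ (l - k) * (2 ^ k * x)" using assms(2) 
    by (metis add.commute le_add_diff_inverse mult.assoc power_add)
  moreover have "2 ^ (l - k) * (2 ^ k * x) \<in> V" by (intro V_intros assms(1))
  ultimately show ?thesis by metis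
qed

lemma common_power_2:
  assumes "finite I" "\<And>i. i \<in> I \<Longrightarrow> dyadic (g i) \<or> g i = 0"
  shows "\<exists>k. \<forall>i\<in>I. 2 ^ k * g i \<in> V"
  using assms
proof (induction I rule: finite_induct)
  case (insert i I)
  then obtain k l where "\<forall>i\<in>I. 2 ^ k * g i \<in> V" "2 ^ l * g i \<in> V"
    using dyadic_cofinal by (metis insertI1 insertI2)
  then show ?case
    by (intro exI[of _ "max k l"]) (auto intro: power_2_mult_mono)
qed auto

text \<open>
  If \<open>b ^ e\<close> is 2 up to a unit, the terms \<open>c j * b ^ j\<close> with \<open>j < e\<close> and dyadic \<open>c j\<close> have
  distinct valuations, so the term of least valuation cannot be cancelled.
\<close>

lemma ramified_independent:
  assumes b: "nonunit b" "b ^ e = 2 * u" "unit u"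
    and c: "\<And>j. j < e \<Longrightarrow> dyadic (c j) \<or> c j = 0"
    and sum0: "(\<Sum>j<e. c j * b ^ j) = 0"
    and j: "j < e"
  shows "c j = 0"
proof (rule ccontr)
  assume cj: "c j \<noteq> 0"
  define J where "J = {j. j < e \<and> c j \<noteq> 0}"
  have J: "finite J" "J \<noteq> {}" using j cj by (auto simp: J_def)
  have b0: "b \<noteq> 0" using b j unit_nonzero by (metis mult_eq_0_iff not_less_zero power_0_left zero_neq_numeral less_numeral_extra(3))
  have "\<exists>k v. unit v \<and> c j * b ^ j = b powi (int e * k + int j) * v" if "j \<in> J" for j
  proof -
    from that c obtain k v where v: "unit v" "c j = 2 powi k * v"
      unfolding J_def dyadic_def by blast
    \<comment> \<open>Every term is a power of \<open>b\<close> times a unit, with exponents that are pairwise distinct modulo \<open>e\<close>.\<close>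
    have two: "2 = b ^ e * inverse u" using b(2) unit_nonzero[OF b(3)] by simp
    have "c j * b ^ j = (b ^ e * inverse u) powi k * v * b ^ j" using v(2) two by simp
    also have "\<dots> = b powi (int e * k + int j) * (inverse u powi k * v)"
      using b0 by (simp add: power_int_mult_distrib power_int_add power_int_mult)
    finally show ?thesis using v(1) b(3) by (blast intro: unit_mult unit_powi unit_inverse)
  qed
  then obtain k v where kv: "\<And>j. j \<in> J \<Longrightarrow> unit (v j)"
      "\<And>j. j \<in> J \<Longrightarrow> c j * b ^ j = b powi (int e * k j + int j) * v j"
    by metis
  define w where "w j = int e * k j + int j" for j
  obtain i where i: "i \<in> J" "\<And>j. j \<in> J \<Longrightarrow> w i \<le> w j"
    using ex_min_if_finite[of "w ` J"] J by (force simp: not_less)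
  have w_neq: "w i \<noteq> w j" if "j \<in> J - {i}" for j
  proof
    assume "w i = w j"
    hence "w i mod int e = w j mod int e" by simp
    thus False using that i(1) by (simp add: w_def J_def flip: of_nat_mod)
  qed
  \<comment> \<open>Dividing by the term of least exponent leaves a unit plus a sum of nonunits.\<close>
  have "0 = b powi (- w i) * (\<Sum>j\<in>J. c j * b ^ j)"
    using sum0 by (subst sum.mono_neutral_left[of "{..<e}" J]) (auto simp: J_def)
  also have "\<dots> = (\<Sum>j\<in>J. b powi (w j - w i) * v j)"
    unfolding sum_distrib_left using b0
    by (intro sum.cong) (auto simp: kv(2) power_int_add[symmetric] mult.assoc[symmetric] simp flip: w_def)
  also have "\<dots> = v i + (\<Sum>j\<in>J - {i}. b powi (w j - w i) * v j)"
    using J i by (simp add: sum.remove)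
  finally have "v i + (\<Sum>j\<in>J - {i}. b powi (w j - w i) * v j) = 0" by simp
  moreover have "nonunit (\<Sum>j\<in>J - {i}. b powi (w j - w i) * v j)"
  proof (intro nonunit_sum nonunit_mult)
    fix j assume j: "j \<in> J - {i}"
    hence "w j - w i > 0" using i(2)[of j] w_neq[of j] by auto
    thus "nonunit (b powi (w j - w i))" by (auto simp: power_int_def intro: nonunit_power b)
    show "v j \<in> V" using j kv in_V by auto
  qed
  ultimately show False
    using unit_add_nonunit[OF kv(1)[OF i(1)]] unit_nonzero by metis
qed

end

lemma valuation_over_2_exists: "\<exists>V :: 'a::field_char_0 set. valuation_over_2 V"
proof -
  have "is_subring (\<int> :: 'a set)" by (auto simp: is_subring_def)
  moreover have "inverse 2 \<notin> (\<int> :: 'a set)"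
  proof
    assume "inverse 2 \<in> (\<int> :: 'a set)"
    then obtain n :: int where "inverse 2 = (of_int n :: 'a)" by (auto elim: Ints_cases)
    hence "(of_int (2 * n) :: 'a) = of_int 1" by (simp add: field_simps)
    hence "2 * n = 1" by (simp only: of_int_eq_iff)
    thus False by presburger
  qed
  ultimately show ?thesis
    using valuation_ring_exists[of "\<int> :: 'a set" 2] unfolding valuation_over_2_def
    by (metis Ints_numeral zero_neq_numeral)
qed

section \<open>Ring homomorphisms\<close>

locale comm_ring_hom =
  fixes h :: "'a::comm_ring_1 \<Rightarrow> 'b::comm_ring_1"
  assumes hom_add: "h (x + y) = h x + h y"
    and hom_mult: "h (x * y) = h x * h y"
    and hom_one: "h 1 = 1"
begin

lemma hom_zero: "h 0 = 0"
  using hom_add[of 0 0] by simp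

lemma hom_uminus: "h (- x) = - h x"
  using hom_add[of x "- x"] by (simp add: hom_zero eq_neg_iff_add_eq_0 add.commute)

lemma hom_diff: "h (x - y) = h x - h y"
  using hom_add[of x "- y"] by (simp add: hom_uminus)

lemma hom_sum: "h (sum g I) = (\<Sum>i\<in>I. h (g i))"
  by (induction I rule: infinite_finite_induct) (auto simp: hom_zero hom_add)

lemma hom_prod: "h (prod g I) = (\<Prod>i\<in>I. h (g i))"
  by (induction I rule: infinite_finite_induct) (auto simp: hom_one hom_mult)

lemma hom_power: "h (x ^ n) = h x ^ n"
  by (induction n) (auto simp: hom_one hom_mult)

lemma hom_of_nat: "h (of_nat n) = of_nat n"
  by (induction n) (auto simp: hom_zero hom_one hom_add)

lemma hom_numeral: "h (numeral n) = numeral n"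
  using hom_of_nat[of "numeral n"] by simp

lemmas homs = hom_add hom_mult hom_one hom_zero hom_uminus hom_diff hom_sum hom_prod hom_power
  hom_numeral

lemma map_poly_comm_ring_hom: "comm_ring_hom (map_poly h)"
proof
  show "map_poly h (x + y) = map_poly h x + map_poly h y" for x y
    by (intro poly_eqI) (simp add: coeff_map_poly homs)
  show "map_poly h (x * y) = map_poly h x * map_poly h y" for x y
    by (intro poly_eqI) (simp add: coeff_map_poly coeff_mult homs)
  show "map_poly h 1 = 1"
    by (simp add: homs)
qed

end

lemma comm_ring_hom_comp:
  "comm_ring_hom g \<Longrightarrow> comm_ring_hom h \<Longrightarrow> comm_ring_hom (\<lambda>x. g (h x))"
  unfolding comm_ring_hom_def by simp

lemma comm_ring_hom_poly: "comm_ring_hom (\<lambda>q. poly q x)"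
  by unfold_locales auto

lemma comm_ring_hom_of_rat: "comm_ring_hom of_rat"
  by unfold_locales (auto simp: of_rat_add of_rat_mult)

lemma comm_ring_hom_const_poly: "comm_ring_hom (\<lambda>c. [:c:])"
  by unfold_locales auto

abbreviation rat_eval :: "'a::field_char_0 \<Rightarrow> rat poly \<Rightarrow> 'a" where
  "rat_eval x g \<equiv> poly (map_poly of_rat g) x"

lemma comm_ring_hom_rat_eval: "comm_ring_hom (rat_eval x)"
  by (intro comm_ring_hom_comp[OF comm_ring_hom_poly] comm_ring_hom.map_poly_comm_ring_hom
        comm_ring_hom_of_rat)

lemma rat_eval_altdef: "degree g \<le> n \<Longrightarrow> rat_eval x g = (\<Sum>i\<le>n. of_rat (coeff g i) * x ^ i)"
  by (subst poly_eq_sum_upto[where n = n]) (auto simp: coeff_map_poly degree_map_poly)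

section \<open>The auxiliary polynomial\<close>

text \<open>
  Modulo 2 this is \<open>y ^ (d - 1) * (y + 1)\<close>, and the constant coefficient is divisible by 2 but not by 4. So
  there is one simple 2-adic unit root, and the others form an Eisenstein factor of degree \<open>d - 1\<close>.
\<close>

definition base_poly :: "nat \<Rightarrow> 'a::comm_ring_1 poly" where
  "base_poly d = monom 1 d + monom 1 (d - 1) + monom 2 (d - 2) + [:2:]"

lemma poly_base_poly: "poly (base_poly d) x = x ^ d + x ^ (d - 1) + 2 * x ^ (d - 2) + 2"
  by (simp add: base_poly_def poly_monom)

lemma degree_base_poly: "d \<ge> 3 \<Longrightarrow> degree (base_poly d :: 'a::comm_ring_1 poly) = d"
  and lead_coeff_base_poly: "d \<ge> 3 \<Longrightarrow> coeff (base_poly d :: 'a::comm_ring_1 poly) d = 1"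
proof -
  assume d: "d \<ge> 3"
  show c: "coeff (base_poly d :: 'a poly) d = 1"
    using d by (auto simp: base_poly_def coeff_pCons split: nat.splits)
  have "degree (base_poly d :: 'a poly) \<le> d"
    unfolding base_poly_def
    by (intro degree_add_le order.trans[OF degree_monom_le]) auto
  thus "degree (base_poly d :: 'a poly) = d"
    using c le_degree[of "base_poly d :: 'a poly" d] by simp
qed

lemma map_base_poly: "map_poly of_rat (base_poly d) = base_poly d"
proof -
  interpret comm_ring_hom "map_poly of_rat :: rat poly \<Rightarrow> 'a poly"
    by (intro comm_ring_hom.map_poly_comm_ring_hom comm_ring_hom_of_rat)
  show ?thesis
    by (simp add: base_poly_def homs map_poly_monom map_poly_pCons)
qed

lemma rat_eval_base_poly: "rat_eval x (base_poly d) = poly (base_poly d) x"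
  by (simp add: map_base_poly)

lemma base_poly_pos:
  fixes x :: "'a::linordered_field"
  assumes "even d" "d \<ge> 2"
  shows "poly (base_poly d) x > 0"
proof -
  define e where "e = d - 2"
  have "d = e + 2" using assms(2) by (simp add: e_def)
  hence "poly (base_poly d) x = x ^ (d - 2) * (x ^ 2 + x + 2) + 2"
    by (simp add: poly_base_poly power2_eq_square algebra_simps)
  moreover have "x ^ (d - 2) \<ge> 0" using assms by (intro zero_le_even_power) auto
  moreover have "x ^ 2 + x + 2 \<ge> 0"
  proof -
    have "x ^ 2 + x + 2 = (x + 1/2) ^ 2 + 7/4" by (simp add: power2_eq_square field_simps)
    also have "\<dots> \<ge> 0" by (intro add_nonneg_nonneg) auto
    finally show ?thesis .
  qed
  ultimately show ?thesis by (simp add: add_nonneg_pos)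
qed

text \<open>
  This is the quotient \<open>(x ^ n - y ^ n) / (x - y)\<close>, which for congruent \<open>x\<close> and \<open>y\<close> stands in for the derivative.
\<close>

definition quot_sum :: "nat \<Rightarrow> 'a::comm_ring_1 \<Rightarrow> 'a \<Rightarrow> 'a" where
  "quot_sum n x y = (\<Sum>i<n. y ^ (n - Suc i) * x ^ i)"

lemma base_poly_diff:
  "poly (base_poly d) x - poly (base_poly d) y =
     (x - y) * (quot_sum d x y + quot_sum (d - 1) x y + 2 * quot_sum (d - 2) x y)"
proof -
  have *: "x ^ n - y ^ n = (x - y) * quot_sum n x y" for n
    unfolding quot_sum_def by (rule power_diff_sumr2)
  have "poly (base_poly d) x - poly (base_poly d) y =
    (x ^ d - y ^ d) + (x ^ (d - 1) - y ^ (d - 1)) + 2 * (x ^ (d - 2) - y ^ (d - 2))"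
    by (simp add: poly_base_poly)
  also have "\<dots> = (x - y) * (quot_sum d x y + quot_sum (d - 1) x y + 2 * quot_sum (d - 2) x y)"
    unfolding * by (simp add: algebra_simps)
  finally show ?thesis .
qed

lemma even_quot_sum:
  fixes x y :: int
  assumes "odd x" "odd y"
  shows "even (quot_sum n x y) \<longleftrightarrow> even n"
  unfolding quot_sum_def using assms by (subst even_sum_iff) auto

text \<open>
  Hensel lifting for the odd root: modulo 2 the derivative is 1 at odd arguments.
\<close>

lemma base_poly_2adic_root:
  assumes "d \<ge> 3"
  shows "\<exists>r::int. odd r \<and> 2 ^ Suc n dvd poly (base_poly d) r"
proof (induction n)
  case 0
  have "even (poly (base_poly d) (1 :: int))" by (simp add: poly_base_poly)
  then show ?case by (intro exI[of _ 1]) simp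
next
  case (Suc n)
  then obtain r s :: int where r: "odd r" "poly (base_poly d) r = 2 ^ Suc n * s" unfolding dvd_def by blast
  show ?case
  proof (cases "even s")
    case True
    then show ?thesis using r by (intro exI[of _ r]) (auto elim!: evenE)
  next
    case False
    define r' where "r' = r + 2 ^ Suc n"
    define k where "k = quot_sum d r' r + quot_sum (d - 1) r' r + 2 * quot_sum (d - 2) r' r"
    have odd_r': "odd r'" using r by (simp add: r'_def)
    have "odd k" using assms by (simp add: k_def even_quot_sum odd_r' r)
    with False obtain m where m: "s + k = 2 * m" by (metis evenE even_add)
    have "poly (base_poly d) r' - poly (base_poly d) r = (r' - r) * k"
      unfolding k_def by (rule base_poly_diff)
    hence "poly (base_poly d) r' = 2 ^ Suc n * (s + k)"
      by (simp only: r(2)) (simp add: r'_def algebra_simps)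
    then show ?thesis using odd_r' m by (intro exI[of _ r']) auto
  qed
qed

context valuation_over_2
begin

text \<open>
  The residue field of \<open>V\<close> may be larger than the field with two elements, so not every unit
  is congruent to 1; odd integers and unit roots are.
\<close>

definition one_unit :: "'a \<Rightarrow> bool" where
  "one_unit x \<longleftrightarrow> nonunit (x - 1)"

lemma one_unit_unit: "one_unit x \<Longrightarrow> unit x"
  using unit_congruent[of x 1] by (simp add: one_unit_def)

lemma one_unit_mult:
  assumes "one_unit x" "one_unit y"
  shows "one_unit (x * y)"
proof -
  have "nonunit ((x - 1) * y + (y - 1))"
    using assms one_unit_unit[of y] by (intro nonunit_add nonunit_mult in_V) (auto simp: one_unit_def)
  thus ?thesis by (simp add: one_unit_def algebra_simps)
qed

lemma one_unit_power: "one_unit x \<Longrightarrow> one_unit (x ^ n)"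
  by (induction n) (auto intro: one_unit_mult simp: one_unit_def[of 1])

lemma one_unit_odd: "odd n \<Longrightarrow> one_unit (of_int n)"
  using nonunit_even by (auto simp: one_unit_def elim!: oddE)

lemma quot_sum_congruent:
  assumes "one_unit x" "one_unit y"
  shows "nonunit (quot_sum n x y - of_nat n)"
proof -
  have "nonunit (\<Sum>i<n. y ^ (n - Suc i) * x ^ i - 1)"
    using assms by (intro nonunit_sum) (auto simp flip: one_unit_def intro!: one_unit_mult one_unit_power)
  thus ?thesis by (simp add: quot_sum_def sum_subtractf)
qed

lemma base_poly_diff_unit:
  assumes "one_unit x" "one_unit y" "d \<ge> 1"
  shows "\<exists>u. unit u \<and> poly (base_poly d) x - poly (base_poly d) y = (x - y) * u"
proof (intro exI conjI)
  define q where "q n = quot_sum n x y" for n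
  have "nonunit ((q d - of_nat d) + (q (d - 1) - of_nat (d - 1)) + 2 * q (d - 2))"
  proof (intro nonunit_add nonunit_mult[OF nonunit_2])
    show "q (d - 2) \<in> V"
      using assms(1,2)[THEN one_unit_unit] in_V unfolding q_def quot_sum_def
      by (intro V_intros) auto
  qed (use quot_sum_congruent[OF assms(1,2)] in \<open>auto simp: q_def\<close>)
  also have "(q d - of_nat d) + (q (d - 1) - of_nat (d - 1)) + 2 * q (d - 2) =
      (q d + q (d - 1) + 2 * q (d - 2)) - of_int (2 * int d - 1)"
    using assms(3) by (simp add: of_nat_diff)
  finally show "unit (q d + q (d - 1) + 2 * q (d - 2))"
    by (rule unit_congruent) (intro unit_odd, simp)
  show "poly (base_poly d) x - poly (base_poly d) y = (x - y) * (q d + q (d - 1) + 2 * q (d - 2))"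
    unfolding q_def by (rule base_poly_diff)
qed

context
  fixes d :: nat
  assumes d: "d \<ge> 3"
begin

lemma base_root_in_V:
  assumes "poly (base_poly d) b = 0"
  shows "b \<in> V"
proof (rule ccontr)
  assume b: "b \<notin> V"
  define y where "y = inverse b"
  have y: "nonunit y" "b \<noteq> 0" using b total[of b] V_intros(4) by (auto simp: nonunit_def y_def)
  have "1 + (y + 2 * y ^ 2 + 2 * y ^ d) = y ^ d * poly (base_poly d) b"
  proof -
    define e where "e = d - 2"
    have e: "d = e + 2" using d by (simp add: e_def)
    have "y ^ d * b ^ d = 1" "y ^ d * b ^ (d - 1) = y" "y ^ d * b ^ (d - 2) = y ^ 2"
      using y(2) by (auto simp: e y_def field_simps power2_eq_square)
    thus ?thesis by (simp add: poly_base_poly algebra_simps)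
  qed
  hence "1 = - (y + 2 * y ^ 2 + 2 * y ^ d)" using assms by (metis eq_neg_iff_add_eq_0 mult_zero_right)
  moreover have "nonunit (- (y + 2 * y ^ 2 + 2 * y ^ d))"
    using y d by (intro nonunit_uminus nonunit_add nonunit_mult[OF nonunit_2])
      (auto intro: in_V(2) nonunit_power subring_power[OF subring])
  ultimately show False using not_nonunit_1 by metis
qed

lemma base_root_eq:
  assumes "poly (base_poly d) b = 0"
  shows "b ^ (d - 1) * (b + 1) = 2 * (- (b ^ (d - 2) + 1))"
proof -
  have "b ^ d = b ^ (d - 1) * b" using d by (simp flip: power_Suc2)
  thus ?thesis using assms by (simp add: poly_base_poly algebra_simps eq_neg_iff_add_eq_0)
qed

lemma base_root_unit:
  assumes "poly (base_poly d) b = 0" "unit b"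
  shows "one_unit b"
proof -
  have "nonunit (2 * (- (b ^ (d - 2) + 1)))"
    using assms in_V by (intro nonunit_mult[OF nonunit_2] V_intros) auto
  hence "nonunit (b ^ (d - 1) * (b + 1))" by (simp only: base_root_eq[OF assms(1)])
  hence "nonunit (b ^ (d - 1)) \<or> nonunit (b + 1)"
    using assms in_V by (intro nonunit_factor V_intros) auto
  hence "nonunit (b + 1)" using unit_power[OF assms(2)] not_unit_nonunit by blast
  from nonunit_diff[OF this nonunit_2] show ?thesis by (simp add: one_unit_def)
qed

text \<open>
  A unit root is a simple root modulo the nonunits, and the only one in its residue class.
\<close>

lemma base_root_unit_unique:
  assumes "poly (base_poly d) a = 0" "unit a" "poly (base_poly d) b = 0" "unit b"
  shows "a = b"
proof -
  obtain u where "unit u" "0 = (a - b) * u"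
    using base_poly_diff_unit[of a b d] base_root_unit assms d by auto
  thus ?thesis using unit_nonzero by auto
qed

text \<open>
  In \<open>b ^ (d - 1) * (b + 1) = - 2 * (b ^ (d - 2) + 1)\<close> the factors \<open>b + 1\<close> and \<open>b ^ (d - 2) + 1\<close> are
  units, so \<open>b\<close> has the valuation of 2 divided by \<open>d - 1\<close>.
\<close>

lemma base_root_nonunit:
  assumes "poly (base_poly d) b = 0" "nonunit b"
  shows "\<exists>u. unit u \<and> b ^ (d - 1) = 2 * u"
proof -
  have u: "unit (1 + b)" "unit (1 + b ^ (d - 2))"
    using assms d by (auto intro!: unit_add_nonunit nonunit_power)
  have "b ^ (d - 1) = 2 * (- ((1 + b ^ (d - 2)) / (1 + b)))"
    using base_root_eq[OF assms(1)] unit_nonzero[OF u(1)] by (simp add: field_simps)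
  thus ?thesis using u by (blast intro: unit_uminus unit_divide)
qed

text \<open>
  An integer \<open>r\<close> at which the polynomial has a high power of 2 is that close to the unit root, because the value
  at \<open>r\<close> is \<open>r - a\<close> times a unit.
\<close>

lemma unit_root_approx:
  assumes "poly (base_poly d) a = 0" "unit a"
  shows "\<exists>r::int. \<exists>v\<in>V. a - of_int r = 2 ^ n * v"
proof -
  obtain r :: int and s where r: "odd r" "poly (base_poly d) r = 2 ^ Suc n * s"
    using base_poly_2adic_root[OF d, of n] unfolding dvd_def by blast
  obtain u where u: "unit u" "poly (base_poly d) a - poly (base_poly d) (of_int r) = (a - of_int r) * u"
    using base_poly_diff_unit[of a "of_int r" d] base_root_unit[OF assms] one_unit_odd[OF r(1)] d by auto
  have "poly (base_poly d) (of_int r :: 'a) = of_int (poly (base_poly d) r)"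
    by (simp add: poly_base_poly)
  hence "(a - of_int r) * u = - of_int (poly (base_poly d) r)"
    using u(2) assms(1) by simp
  also have "\<dots> = 2 ^ n * (- 2 * of_int s)" by (simp add: r(2))
  finally have "(a - of_int r) * u = 2 ^ n * (- 2 * of_int s)" .
  hence "a - of_int r = 2 ^ n * (- 2 * of_int s * inverse u)"
    using unit_nonzero[OF u(1)] by (simp add: field_simps)
  moreover have "- 2 * of_int s * inverse u \<in> V"
    using in_V(1)[OF unit_inverse[OF u(1)]] V_intros(11,5,6,12) by (intro V_intros) auto
  ultimately show ?thesis by blast
qed

text \<open>
  The completion of \<open>\<rat>(a)\<close> at \<open>V\<close> is \<open>\<rat>\<^sub>2\<close>: an integer close to \<open>a\<close> can replace \<open>a\<close> in \<open>g\<close>.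
\<close>

lemma unit_root_dyadic:
  assumes a: "poly (base_poly d) a = 0" "unit a"
    and irred: "irreducible (base_poly d :: rat poly)"
    and nz: "rat_eval a g \<noteq> 0"
  shows "dyadic (rat_eval a g)"
proof -
  interpret ev: comm_ring_hom "rat_eval a" by (rule comm_ring_hom_rat_eval)
  have "\<not> base_poly d dvd g"
    using nz a by (auto elim!: dvdE simp: ev.homs rat_eval_base_poly)
  hence "coprime (base_poly d) g"
    using irred by (simp add: prime_elem_imp_coprime irreducible_imp_prime_elem)
  then obtain s b where "s * base_poly d + b * g = 1"
    using bezout_coefficients_fst_snd[of "base_poly d" g] by auto
  hence "rat_eval a (s * base_poly d + b * g) = 1" by (simp add: ev.homs)
  hence bg: "rat_eval a b * rat_eval a g = 1" by (simp add: ev.homs rat_eval_base_poly a)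
  \<comment> \<open>Rationals are dyadic, so a power of 2 suffices as common denominator over \<open>V\<close>.\<close>
  have clear: "\<exists>k. \<forall>i. 2 ^ k * of_rat (coeff q i) \<in> V" for q :: "rat poly"
  proof -
    obtain k where "\<forall>i\<in>{..degree q}. 2 ^ k * of_rat (coeff q i) \<in> V"
      using common_power_2[of "{..degree q}" "\<lambda>i. of_rat (coeff q i)"] dyadic_of_rat by auto
    hence "2 ^ k * of_rat (coeff q i) \<in> V" for i
      by (cases "i \<le> degree q") (auto simp: coeff_eq_0 V_intros)
    thus ?thesis by blast
  qed
  obtain k where k: "\<And>i. 2 ^ k * of_rat (coeff g i) \<in> V" using clear by blast
  obtain l where l: "\<And>i. 2 ^ l * of_rat (coeff b i) \<in> V" using clear by blast
  have aV: "a \<in> V" using a in_V by blast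
  define n where "n = k + l + 1"
  obtain r :: int and v where r: "v \<in> V" "a - of_int r = 2 ^ n * v"
    using unit_root_approx[OF a] by blast
  have rV: "of_int r \<in> V" by (rule V_intros)
  define G :: "'a poly" where "G = smult (2 ^ k) (map_poly of_rat g)"
  define x where "x = poly G a"
  define y where "y = poly G (of_int r)"
  have GV: "coeff G i \<in> V" for i using k by (simp add: G_def coeff_map_poly)
  have xg: "x = 2 ^ k * rat_eval a g" by (simp add: x_def G_def)
  have y_rat: "y = of_rat (2 ^ k * poly g (of_int r))"
  proof -
    have "(of_rat (poly g (of_int r)) :: 'a) = rat_eval (of_int r) g"
      by (simp add: poly_altdef of_rat_sum of_rat_mult of_rat_power coeff_map_poly degree_map_poly)
    thus ?thesis by (simp add: y_def G_def of_rat_mult of_rat_power)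
  qed
  have diff: "\<exists>w\<in>V. x - y = 2 ^ n * w"
  proof -
    have "x - y = (\<Sum>i\<le>degree G. coeff G i * (a ^ i - of_int r ^ i))"
      by (simp add: x_def y_def poly_altdef sum_subtractf algebra_simps)
    also have "\<dots> = (\<Sum>i\<le>degree G. 2 ^ n * (v * (coeff G i * quot_sum i a (of_int r))))"
    proof (intro sum.cong refl)
      fix i
      have "a ^ i - of_int r ^ i = (2 ^ n * v) * quot_sum i a (of_int r)"
        unfolding quot_sum_def r(2)[symmetric] by (rule power_diff_sumr2)
      then show "coeff G i * (a ^ i - of_int r ^ i) = 2 ^ n * (v * (coeff G i * quot_sum i a (of_int r)))"
        by (simp add: mult_ac)
    qed
    finally have "x - y = 2 ^ n * (\<Sum>i\<le>degree G. v * (coeff G i * quot_sum i a (of_int r)))"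
      by (simp add: sum_distrib_left)
    moreover have "(\<Sum>i\<le>degree G. v * (coeff G i * quot_sum i a (of_int r))) \<in> V"
      unfolding quot_sum_def by (intro V_intros GV aV rV r(1))
    ultimately show ?thesis by blast
  qed
  then obtain w where w: "w \<in> V" "x - y = 2 ^ n * w" by blast
  \<comment> \<open>The inverse of \<open>rat_eval a g\<close> is in \<open>2 powi (- l) * V\<close>, so \<open>x\<close> has valuation at most \<open>k + l < n\<close>.\<close>
  have not_small: "x \<noteq> 2 ^ n * z" if "z \<in> V" for z
  proof
    assume xz: "x = 2 ^ n * z"
    define B where "B = 2 ^ l * rat_eval a b"
    have BV: "B \<in> V"
    proof -
      have "B = poly (smult (2 ^ l) (map_poly of_rat b)) a" by (simp add: B_def)
      also have "\<dots> \<in> V" using l by (intro subring_poly[OF subring] aV) (simp add: coeff_map_poly)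
      finally show ?thesis .
    qed
    have "2 ^ (k + l) * (2 * (B * z)) = B * x" by (simp add: xz n_def mult_ac)
    also have "\<dots> = 2 ^ (k + l) * (rat_eval a b * rat_eval a g)"
      by (simp add: B_def xg power_add)
    finally have "2 * (B * z) = 1" using bg by simp
    hence "inverse 2 = B * z" by (rule inverse_unique)
    thus False using half V_intros(3)[OF BV that] by metis
  qed
  have "y \<noteq> 0" using not_small[OF w(1)] w(2) by auto
  then obtain j u where u: "unit u" "y = 2 powi j * u"
    using y_rat dyadic_of_rat[of "2 ^ k * poly g (of_int r)"] by (auto simp: dyadic_def)
  have jn: "j < int n"
  proof (rule ccontr)
    assume "\<not> j < int n"
    hence "(2 :: 'a) powi j = 2 ^ n * 2 ^ nat (j - int n)"
      by (simp add: power_int_def flip: power_add) (simp add: nat_diff_distrib)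
    hence "x = 2 ^ n * (2 ^ nat (j - int n) * u + w)"
      using u w by (simp add: algebra_simps)
    moreover have "2 ^ nat (j - int n) * u + w \<in> V" by (intro V_intros in_V(1)[OF u(1)] w)
    ultimately show False using not_small by blast
  qed
  have "(2 :: 'a) ^ n = 2 powi j * 2 ^ nat (int n - j)"
    using jn by (simp flip: power_int_add power_int_of_nat)
  hence "x = 2 powi j * (u + 2 ^ nat (int n - j) * w)"
    using u w by (simp add: algebra_simps)
  moreover have "unit (u + 2 ^ nat (int n - j) * w)"
    using jn by (intro unit_add_nonunit u nonunit_mult nonunit_power nonunit_2 w) auto
  ultimately have "dyadic x" unfolding dyadic_def by blast
  hence "dyadic (inverse (2 ^ k) * x)"
    using dyadic_of_rat[of "inverse (2 ^ k)"]
    by (intro dyadic_mult) (auto simp: of_rat_inverse of_rat_power)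
  moreover have "inverse (2 ^ k) * x = rat_eval a g" by (simp add: xg flip: mult.assoc)
  ultimately show ?thesis by metis
qed

end

end

section \<open>A root whose conjugate has large degree over it\<close>

text \<open>
  Since \<open>a\<close> is the only unit root and is not real, its conjugate is a nonunit root, to which
  \<open>ramified_independent\<close> applies: with rational coefficients for irreducibility, and with
  coefficients from \<open>\<rat>(a)\<close> for the second claim.
\<close>

lemma
  assumes d: "d \<ge> 4" "even d"
  shows irreducible_base_poly: "irreducible (base_poly d :: rat poly)" (is ?irred)
    and conjugate_root_independent: "\<exists>a :: complex. poly (base_poly d) a = 0 \<and>
      (\<forall>H :: rat poly poly. degree H < d - 1 \<longrightarrow>
         poly (map_poly (rat_eval a) H) (cnj a) = 0 \<longrightarrow> (\<forall>j. base_poly d dvd coeff H j))"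
      (is ?indep)
proof -
  obtain V :: "complex set" where "valuation_over_2 V" using valuation_over_2_exists by blast
  then interpret valuation_over_2 V .
  have d3: "d \<ge> 3" using d by simp
  note root_simps = degree_base_poly[OF d3] lead_coeff_base_poly[OF d3]
  obtain root where root: "(\<Prod>i<d. [:- root i, 1:]) = (base_poly d :: complex poly)"
    using complex_poly_decompose'[of "base_poly d"] by (auto simp: root_simps)
  have zero: "poly (base_poly d) (root i) = 0" if "i < d" for i
    unfolding root[symmetric] poly_prod using that by (intro prod_zero) auto
  \<comment> \<open>The value 4 at \<open>- 1\<close> is a nonunit, so some root is congruent to \<open>- 1\<close>.\<close>
  have "(\<Prod>i<d. - 1 - root i) = poly (base_poly d) (- 1)"
    unfolding root[symmetric] poly_prod by (simp add: algebra_simps)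
  also have "\<dots> = 2 * 2" using d by (simp add: poly_base_poly)
  finally have "(\<Prod>i<d. - 1 - root i) = 2 * 2" .
  moreover have "nonunit (2 * 2)" by (intro nonunit_mult nonunit_2 V_intros)
  ultimately have "nonunit (\<Prod>i<d. - 1 - root i)" by simp
  hence "\<exists>i\<in>{..<d}. nonunit (- 1 - root i)"
    using base_root_in_V[OF d3 zero] by (intro nonunit_prod_factor) (auto intro: subring_diff[OF subring] V_intros)
  then obtain i where i: "i < d" "nonunit (- 1 - root i)" by blast
  define a where "a = root i"
  define b where "b = cnj a"
  have a: "poly (base_poly d) a = 0" "unit a"
    using zero[OF i(1)] unit_congruent[of "root i" "- 1"] nonunit_uminus[OF i(2)] unit_uminus[OF unit_1]
    by (auto simp: a_def algebra_simps)
  have b: "poly (base_poly d) b = 0"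
  proof -
    have "poly (base_poly d) b = cnj (poly (base_poly d) a)" by (simp add: b_def poly_base_poly)
    thus ?thesis using a by simp
  qed
  have "b \<noteq> a"
  proof
    assume "b = a"
    then obtain r where r: "a = complex_of_real r" unfolding b_def by (metis Reals_cnj_iff Reals_cases)
    have "complex_of_real (poly (base_poly d) r) = poly (base_poly d) a" by (simp add: r poly_base_poly)
    thus False using base_poly_pos[of d r] a d by simp
  qed
  hence nb: "nonunit b"
    using base_root_unit_unique[OF d3 b _ a] unit_or_nonunit base_root_in_V[OF d3 b] by blast
  obtain u where u: "unit u" "b ^ (d - 1) = 2 * u" using base_root_nonunit[OF d3 b nb] by blast
  have rat_indep: "g = 0" if "degree g < d - 1" "rat_eval b g = 0" for g
  proof -
    have "(\<Sum>j<d - 1. of_rat (coeff g j) * b ^ j) = 0"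
      using rat_eval_altdef[of g "d - 2" b] that by (simp add: lessThan_Suc_atMost[symmetric] Suc_diff_Suc numeral_2_eq_2 d)
    hence "of_rat (coeff g j) = (0::complex)" if "j < d - 1" for j
      using dyadic_of_rat by (intro ramified_independent[OF nb u(2,1) _ _ that, of "\<lambda>j. of_rat (coeff g j)"]) auto
    thus "g = 0" using that(1) by (metis leading_coeff_0_iff of_rat_eq_0_iff)
  qed
  have deg: "degree (base_poly d :: rat poly) = d" by (rule root_simps)
  show irred: ?irred
  proof (rule irreducibleI)
    show nz: "(base_poly d :: rat poly) \<noteq> 0"
      using deg d by (cases "base_poly d = (0 :: rat poly)") auto
    show "\<not> (base_poly d :: rat poly) dvd 1"
      using is_unit_iff_degree[OF nz] deg d by simp
    have *: "g dvd 1" if eq: "base_poly d = f * g" and f: "rat_eval b f = 0" for f g :: "rat poly"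
    proof -
      have nz: "f \<noteq> 0" "g \<noteq> 0" using eq root_simps(1)[where 'a = rat] d by auto
      have "degree f \<ge> d - 1" using rat_indep[OF _ f] nz by force
      moreover have "degree f + degree g = d" using degree_mult_eq[OF nz] root_simps eq by metis
      ultimately have "degree g \<le> 1" by linarith
      moreover have "degree g \<noteq> 1"
      proof
        assume "degree g = 1"
        then obtain c e where "g = [:c, e:]" "e \<noteq> 0" by (rule degree1_coeffs)
        hence "poly g (- c / e) = 0" by simp
        hence "poly (base_poly d) (- c / e) = 0" unfolding eq by simp
        thus False using base_poly_pos[of d "- c / e"] d by simp
      qed
      ultimately show ?thesis using nz by (simp add: is_unit_iff_degree)
    qed
    show "f dvd 1 \<or> g dvd 1" if eq: "base_poly d = f * g" for f g :: "rat poly"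
    proof -
      interpret ev: comm_ring_hom "rat_eval b" by (rule comm_ring_hom_rat_eval)
      have "rat_eval b f * rat_eval b g = 0"
        using b unfolding rat_eval_base_poly[symmetric] eq by (simp add: ev.homs)
      thus ?thesis using *[OF eq] *[of g f] eq by (auto simp: mult.commute)
    qed
  qed
  show ?indep
  proof (intro exI[of _ a] conjI allI impI a)
    fix H :: "rat poly poly" and j
    assume deg: "degree H < d - 1" and zero: "poly (map_poly (rat_eval a) H) (cnj a) = 0"
    interpret ev: comm_ring_hom "rat_eval a" by (rule comm_ring_hom_rat_eval)
    have "degree (map_poly (rat_eval a) H) \<le> d - 2"
      using map_poly_degree_leq[of "rat_eval a" H] deg by (simp add: ev.homs)
    hence "(\<Sum>j<d - 1. rat_eval a (coeff H j) * b ^ j) = 0"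
      using zero poly_eq_sum_upto[of "map_poly (rat_eval a) H" "d - 2" b] d
      by (simp add: coeff_map_poly ev.homs b_def lessThan_Suc_atMost[symmetric] Suc_diff_Suc numeral_2_eq_2)
    hence "rat_eval a (coeff H j) = 0" if "j < d - 1"
      using unit_root_dyadic[OF d3 a irred]
      by (intro ramified_independent[OF nb u(2,1) _ _ that, of "\<lambda>j. rat_eval a (coeff H j)"]) auto
    hence zero_j: "rat_eval a (coeff H j) = 0"
      using deg by (cases "j < d - 1") (auto simp: coeff_eq_0 ev.homs)
    show "base_poly d dvd coeff H j"
    proof (rule ccontr)
      assume "\<not> base_poly d dvd coeff H j"
      hence "coprime (base_poly d) (coeff H j)"
        using irred by (simp add: prime_elem_imp_coprime irreducible_imp_prime_elem)
      then obtain s t where "s * base_poly d + t * coeff H j = 1"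
        using bezout_coefficients_fst_snd[of "base_poly d" "coeff H j"] by auto
      hence "rat_eval a (s * base_poly d + t * coeff H j) = 1" by (simp add: ev.homs)
      thus False by (simp add: ev.homs rat_eval_base_poly a zero_j)
    qed
  qed
qed

section \<open>Evaluation of multivariate polynomials\<close>

abbreviation const :: "'a::zero \<Rightarrow> 'a mpoly" where
  "const c \<equiv> Poly_Mapping.single 0 c"

definition var :: "nat \<Rightarrow> 'a::zero_neq_one mpoly" where
  "var i = Poly_Mapping.single (Poly_Mapping.single i 1) 1"

lemma comm_ring_hom_const: "comm_ring_hom (const :: 'a::comm_ring_1 \<Rightarrow> 'a mpoly)"
  by unfold_locales (auto simp: single_add mult_single)

lemma poly_mapping_eq_sum_single:
  "p = (\<Sum>m\<in>Poly_Mapping.keys p. Poly_Mapping.single m (Poly_Mapping.lookup p m))"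
  by (rule poly_mapping_eqI)
     (auto simp: lookup_sum lookup_single when_def in_keys_iff)

definition mono_eval :: "(nat \<Rightarrow> 'b::comm_monoid_mult) \<Rightarrow> (nat \<Rightarrow>\<^sub>0 nat) \<Rightarrow> 'b" where
  "mono_eval x m = (\<Prod>i\<in>Poly_Mapping.keys m. x i ^ Poly_Mapping.lookup m i)"

lemma mono_eval_superset:
  "finite S \<Longrightarrow> Poly_Mapping.keys m \<subseteq> S \<Longrightarrow> mono_eval x m = (\<Prod>i\<in>S. x i ^ Poly_Mapping.lookup m i)"
  unfolding mono_eval_def by (intro prod.mono_neutral_left) (auto simp: in_keys_iff)

lemma mono_eval_0: "mono_eval x 0 = 1"
  by (simp add: mono_eval_def)

lemma mono_eval_add: "mono_eval x (m + n) = mono_eval x m * mono_eval x n"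
proof -
  define S where "S = Poly_Mapping.keys m \<union> Poly_Mapping.keys n"
  have "finite S" "Poly_Mapping.keys m \<subseteq> S" "Poly_Mapping.keys n \<subseteq> S" "Poly_Mapping.keys (m + n) \<subseteq> S"
    using keys_add[of m n] by (auto simp: S_def)
  thus ?thesis
    by (simp add: mono_eval_superset[of S] lookup_add power_add prod.distrib)
qed

lemma mono_eval_single: "mono_eval x (Poly_Mapping.single i k) = x i ^ k"
  by (simp add: mono_eval_def)

lemma (in comm_ring_hom) hom_mono_eval: "h (mono_eval x m) = mono_eval (\<lambda>i. h (x i)) m"
  by (simp add: mono_eval_def homs)

definition mpoly_eval :: "('a::comm_ring_1 \<Rightarrow> 'b::comm_ring_1) \<Rightarrow> (nat \<Rightarrow> 'b) \<Rightarrow> 'a mpoly \<Rightarrow> 'b" where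
  "mpoly_eval h x p = (\<Sum>m\<in>Poly_Mapping.keys p. h (Poly_Mapping.lookup p m) * mono_eval x m)"

context comm_ring_hom
begin

lemma mpoly_eval_superset:
  assumes "finite S" "Poly_Mapping.keys p \<subseteq> S"
  shows "mpoly_eval h x p = (\<Sum>m\<in>S. h (Poly_Mapping.lookup p m) * mono_eval x m)"
  unfolding mpoly_eval_def using assms
  by (intro sum.mono_neutral_left) (auto simp: in_keys_iff hom_zero)

lemma mpoly_eval_single: "mpoly_eval h x (Poly_Mapping.single m c) = h c * mono_eval x m"
  by (simp add: mpoly_eval_def hom_zero)

lemma mpoly_eval_const: "mpoly_eval h x (const c) = h c"
  by (simp add: mpoly_eval_single mono_eval_0)

lemma mpoly_eval_var: "mpoly_eval h x (var i) = x i"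
  by (simp add: var_def mpoly_eval_single mono_eval_single hom_one)

lemma mpoly_eval_add: "mpoly_eval h x (p + q) = mpoly_eval h x p + mpoly_eval h x q"
proof -
  define S where "S = Poly_Mapping.keys p \<union> Poly_Mapping.keys q"
  have "finite S" "Poly_Mapping.keys p \<subseteq> S" "Poly_Mapping.keys q \<subseteq> S" "Poly_Mapping.keys (p + q) \<subseteq> S"
    using keys_add[of p q] by (auto simp: S_def)
  thus ?thesis
    by (simp add: mpoly_eval_superset[of S] lookup_add hom_add distrib_right sum.distrib)
qed

lemma mpoly_eval_sum: "mpoly_eval h x (sum g I) = (\<Sum>i\<in>I. mpoly_eval h x (g i))"
  by (induction I rule: infinite_finite_induct) (auto simp: mpoly_eval_add mpoly_eval_def[of h x 0])

lemma comm_ring_hom_mpoly_eval: "comm_ring_hom (mpoly_eval h x)"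
proof
  show "mpoly_eval h x (p * q) = mpoly_eval h x p * mpoly_eval h x q" for p q
  proof -
    let ?K = Poly_Mapping.keys and ?L = Poly_Mapping.lookup
    have "p * q = (\<Sum>m\<in>?K p. Poly_Mapping.single m (?L p m)) * (\<Sum>n\<in>?K q. Poly_Mapping.single n (?L q n))"
      by (simp flip: poly_mapping_eq_sum_single)
    also have "\<dots> = (\<Sum>m\<in>?K p. \<Sum>n\<in>?K q. Poly_Mapping.single (m + n) (?L p m * ?L q n))"
      by (simp add: sum_product mult_single)
    also have "mpoly_eval h x \<dots> = (\<Sum>m\<in>?K p. \<Sum>n\<in>?K q.
        (h (?L p m) * mono_eval x m) * (h (?L q n) * mono_eval x n))"
      by (simp add: mpoly_eval_sum mpoly_eval_single mono_eval_add hom_mult mult_ac)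
    also have "\<dots> = mpoly_eval h x p * mpoly_eval h x q"
      by (simp add: mpoly_eval_def sum_product)
    finally show ?thesis .
  qed
  show "mpoly_eval h x 1 = 1"
    using mpoly_eval_const[of x 1] by (simp add: hom_one)
qed (rule mpoly_eval_add)

lemma hom_mpoly_eval: "h (mpoly_eval g x p) = mpoly_eval (\<lambda>c. h (g c)) (\<lambda>i. h (x i)) p"
  by (simp add: mpoly_eval_def homs hom_mono_eval)

end

lemma var_power: "(var i :: 'a::comm_ring_1 mpoly) ^ k = Poly_Mapping.single (Poly_Mapping.single i k) 1"
  by (induction k) (auto simp: var_def mult_single simp flip: single_add)

lemma mono_eval_var: "mono_eval var m = (Poly_Mapping.single m 1 :: 'a::comm_ring_1 mpoly)"
proof -
  have "(\<Prod>i\<in>S. var i ^ Poly_Mapping.lookup m i) =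
     (Poly_Mapping.single (\<Sum>i\<in>S. Poly_Mapping.single i (Poly_Mapping.lookup m i)) 1 :: 'a mpoly)" for S
    by (induction S rule: infinite_finite_induct) (auto simp: var_power mult_single)
  thus ?thesis by (simp add: mono_eval_def flip: poly_mapping_eq_sum_single)
qed

text \<open>
  Seen as an evaluation, a coefficientwise map inherits multiplicativity.
\<close>

lemma (in comm_ring_hom) map_eq_mpoly_eval:
  "Poly_Mapping.map h p = mpoly_eval (\<lambda>c. const (h c)) var p"
proof (rule poly_mapping_eqI)
  fix m
  show "Poly_Mapping.lookup (Poly_Mapping.map h p) m =
    Poly_Mapping.lookup (mpoly_eval (\<lambda>c. const (h c)) var p) m"
    by (auto simp: mpoly_eval_def mono_eval_var mult_single lookup_sum lookup_single when_def
        map.rep_eq in_keys_iff hom_zero)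
qed

lemma (in comm_ring_hom) comm_ring_hom_map: "comm_ring_hom (Poly_Mapping.map h :: 'a mpoly \<Rightarrow> 'b mpoly)"
proof -
  interpret c: comm_ring_hom "\<lambda>c. const (h c)"
    by (intro comm_ring_hom_comp[OF comm_ring_hom_const comm_ring_hom_axioms])
  have "(Poly_Mapping.map h :: 'a mpoly \<Rightarrow> 'b mpoly) = mpoly_eval (\<lambda>c. const (h c)) var" by (rule ext) (rule map_eq_mpoly_eval)
  thus ?thesis using c.comm_ring_hom_mpoly_eval[of var] by (simp only:)
qed

lemma (in comm_ring_hom) map_var: "Poly_Mapping.map h (var i) = var i"
  by (simp add: var_def homs)

lemma comm_ring_hom_base_change: "comm_ring_hom base_change"
  unfolding base_change_def[abs_def] by (rule comm_ring_hom.comm_ring_hom_map[OF comm_ring_hom_of_rat])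

subsection \<open>Polynomials in the first variables, and forms\<close>

lemma is_subring_polys: "is_subring (polys n :: 'a::comm_ring_1 mpoly set)"
  unfolding is_subring_def
proof (intro conjI ballI)
  show "1 \<in> (polys n :: 'a mpoly set)" by (auto simp: polys_def)
next
  fix p q :: "'a mpoly" assume p: "p \<in> polys n" and q: "q \<in> polys n"
  show "p - q \<in> polys n"
    unfolding polys_def
  proof (intro CollectI ballI)
    fix m assume "m \<in> Poly_Mapping.keys (p - q)"
    hence "m \<in> Poly_Mapping.keys p \<or> m \<in> Poly_Mapping.keys q"
      by (auto simp: in_keys_iff lookup_minus)
    thus "Poly_Mapping.keys m \<subseteq> {..n}" using p q by (auto simp: polys_def)
  qed
  show "p * q \<in> polys n"
    unfolding polys_def
  proof (intro CollectI ballI)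
    fix m assume "m \<in> Poly_Mapping.keys (p * q)"
    then obtain a b where "m = a + b" "a \<in> Poly_Mapping.keys p" "b \<in> Poly_Mapping.keys q"
      using keys_mult[of p q] by blast
    thus "Poly_Mapping.keys m \<subseteq> {..n}" using p q keys_add[of a b] by (fastforce simp: polys_def)
  qed
qed

lemma const_in_polys: "const c \<in> polys n"
  by (auto simp: polys_def)

lemma var_in_polys: "i \<le> n \<Longrightarrow> var i \<in> polys n"
  by (auto simp: polys_def var_def)

lemma map_in_polys: "p \<in> polys n \<Longrightarrow> Poly_Mapping.map h p \<in> polys n"
  by (auto simp: polys_def in_keys_iff map.rep_eq when_def split: if_splits)

lemma mon_degree_superset:
  "finite S \<Longrightarrow> Poly_Mapping.keys m \<subseteq> S \<Longrightarrow> mon_degree m = (\<Sum>i\<in>S. Poly_Mapping.lookup m i)"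
  unfolding mon_degree_def by (intro sum.mono_neutral_left) (auto simp: in_keys_iff)

lemma mon_degree_add: "mon_degree (a + b) = mon_degree a + mon_degree b"
proof -
  define S where "S = Poly_Mapping.keys a \<union> Poly_Mapping.keys b"
  have "finite S" "Poly_Mapping.keys a \<subseteq> S" "Poly_Mapping.keys b \<subseteq> S" "Poly_Mapping.keys (a + b) \<subseteq> S"
    using keys_add[of a b] by (auto simp: S_def)
  thus ?thesis by (simp add: mon_degree_superset[of S] lookup_add sum.distrib)
qed

lemma mon_degree_eq_0: "mon_degree m = 0 \<longleftrightarrow> m = 0"
  by (auto simp: mon_degree_def in_keys_iff intro!: poly_mapping_eqI)

lemma is_form_mult:
  fixes p q :: "'a::comm_ring_1 mpoly"
  shows "is_form a p \<Longrightarrow> is_form b q \<Longrightarrow> is_form (a + b) (p * q)"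
  using keys_mult[of p q] unfolding is_form_def by (force simp: mon_degree_add)

lemma is_form_add:
  fixes p q :: "'a::comm_ring_1 mpoly"
  shows "is_form a p \<Longrightarrow> is_form a q \<Longrightarrow> is_form a (p + q)"
  using keys_add[of p q] unfolding is_form_def by blast

lemma is_form_const: "is_form 0 (const c)"
  by (auto simp: is_form_def mon_degree_def)

lemma is_form_var: "is_form 1 (var i)"
  by (auto simp: is_form_def var_def mon_degree_def)

lemma is_form_prod:
  fixes l :: "nat \<Rightarrow> 'a::comm_ring_1 mpoly"
  shows "(\<And>i. i < d \<Longrightarrow> is_form 1 (l i)) \<Longrightarrow> is_form d (\<Prod>i<d. l i)"
proof (induction d)
  case 0
  then show ?case using is_form_const[of "1 :: 'a"] by simp
next
  case (Suc d)
  then show ?case using is_form_mult[of d "\<Prod>i<d. l i" 1 "l d"] by simp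
qed

text \<open>
  Substituting \<open>s * var i\<close> for \<open>var i\<close>, with a new variable \<open>s\<close>, separates the homogeneous
  components. The degree in \<open>s\<close> is the total degree, which over a domain is thus additive on products.
\<close>

definition scale_vars :: "'a::comm_ring_1 mpoly \<Rightarrow> 'a mpoly poly" where
  "scale_vars p = mpoly_eval (\<lambda>c. [:const c:]) (\<lambda>i. monom (var i) 1) p"

lemma comm_ring_hom_scale_vars: "comm_ring_hom scale_vars"
  unfolding scale_vars_def[abs_def]
  by (intro comm_ring_hom.comm_ring_hom_mpoly_eval comm_ring_hom_comp[OF comm_ring_hom_const_poly]
      comm_ring_hom_const)

lemma mono_eval_monom:
  fixes x :: "nat \<Rightarrow> 'a::comm_ring_1"
  shows "mono_eval (\<lambda>i. monom (x i) 1) m = monom (mono_eval x m) (mon_degree m)"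
proof -
  have "(\<Prod>i\<in>S. monom (x i) 1 ^ k i) = monom (\<Prod>i\<in>S. x i ^ k i) (\<Sum>i\<in>S. k i)" for S and k :: "nat \<Rightarrow> nat"
    by (induction S rule: infinite_finite_induct) (auto simp: mult_monom monom_power)
  thus ?thesis by (simp add: mono_eval_def mon_degree_def)
qed

lemma lookup_coeff_scale_vars:
  "Poly_Mapping.lookup (coeff (scale_vars p) k) m = (if mon_degree m = k then Poly_Mapping.lookup p m else 0)"
proof -
  have "coeff (scale_vars p) k =
    (\<Sum>m\<in>Poly_Mapping.keys p. if mon_degree m = k then Poly_Mapping.single m (Poly_Mapping.lookup p m) else 0)"
    unfolding scale_vars_def mpoly_eval_def mono_eval_monom mono_eval_var
    by (auto simp: coeff_sum mult_single smult_monom intro!: sum.cong)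
  also have "Poly_Mapping.lookup \<dots> m = (\<Sum>m'\<in>Poly_Mapping.keys p.
      if m' = m then (if mon_degree m = k then Poly_Mapping.lookup p m else 0) else 0)"
    unfolding lookup_sum by (intro sum.cong refl) (auto simp: lookup_single when_def)
  also have "\<dots> = (if mon_degree m = k then Poly_Mapping.lookup p m else 0)"
    by (auto simp: in_keys_iff)
  finally show ?thesis .
qed

lemma scale_vars_eq_0_iff: "scale_vars p = 0 \<longleftrightarrow> p = 0"
proof
  assume zero: "scale_vars p = 0"
  show "p = 0"
  proof (rule poly_mapping_eqI)
    show "Poly_Mapping.lookup p m = Poly_Mapping.lookup 0 m" for m
      using lookup_coeff_scale_vars[of p "mon_degree m" m] zero by simp
  qed
qed (simp add: scale_vars_def mpoly_eval_def)

lemma mon_degree_le_scale_vars: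
  assumes "m \<in> Poly_Mapping.keys p"
  shows "mon_degree m \<le> degree (scale_vars p)"
proof (rule le_degree)
  have "Poly_Mapping.lookup (coeff (scale_vars p) (mon_degree m)) m \<noteq> 0"
    using assms by (simp add: lookup_coeff_scale_vars in_keys_iff)
  thus "coeff (scale_vars p) (mon_degree m) \<noteq> 0" by auto
qed

lemma degree_scale_vars_form: "is_form d p \<Longrightarrow> degree (scale_vars p) \<le> d"
  by (intro degree_le allI impI poly_mapping_eqI)
     (auto simp: lookup_coeff_scale_vars is_form_def in_keys_iff)

lemma degree_mpoly_eval_le:
  fixes x :: "nat \<Rightarrow> 'b::comm_ring_1 poly" and p :: "'a::comm_ring_1 mpoly"
  assumes "\<And>i. degree (x i) \<le> 1"
  shows "degree (mpoly_eval (\<lambda>c. [:h c:]) x p) \<le> degree (scale_vars p)"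
  unfolding mpoly_eval_def
proof (intro degree_sum_le finite_keys)
  fix m assume m: "m \<in> Poly_Mapping.keys p"
  have "degree (\<Prod>i\<in>S. x i ^ k i) \<le> (\<Sum>i\<in>S. k i)" for S and k :: "nat \<Rightarrow> nat"
  proof (induction S rule: infinite_finite_induct)
    case (insert i S)
    have "degree (x i ^ k i) \<le> k i"
      using degree_power_le[of "x i" "k i"] mult_le_mono1[OF assms, of i "k i"] by linarith
    then show ?case
      using insert degree_mult_le[of "x i ^ k i" "\<Prod>i\<in>S. x i ^ k i"] by simp
  qed auto
  hence "degree (mono_eval x m) \<le> mon_degree m" by (simp add: mono_eval_def mon_degree_def)
  thus "degree ([:h (Poly_Mapping.lookup p m):] * mono_eval x m) \<le> degree (scale_vars p)"
    using mon_degree_le_scale_vars[OF m] degree_smult_le[of "h (Poly_Mapping.lookup p m)" "mono_eval x m"]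
    by simp
qed

section \<open>The norm form\<close>

text \<open>
  The product of \<open>x + a y + a\<^sup>2 z\<close> over the roots \<open>a\<close> of a polynomial \<open>q\<close> of degree \<open>e\<close> can be expressed by the
  coefficients of \<open>q\<close>. If \<open>u\<close> and \<open>w\<close> are the roots of \<open>z T\<^sup>2 + y T + x\<close>, then \<open>x + a y + a\<^sup>2 z = z (u - a) (w - a)\<close>,
  so for monic \<open>q\<close> the product is \<open>z\<^sup>e q(u) q(w)\<close>. This is symmetric in \<open>u\<close> and \<open>w\<close>, and the expansion of
  its double involves only power sums of \<open>u\<close> and \<open>w\<close>, for which Newton's recursion holds.
\<close>

fun power_sum2 :: "'a::comm_ring_1 \<Rightarrow> 'a \<Rightarrow> nat \<Rightarrow> 'a" where
  "power_sum2 s t 0 = 2"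
| "power_sum2 s t (Suc 0) = s"
| "power_sum2 s t (Suc (Suc j)) = s * power_sum2 s t (Suc j) - t * power_sum2 s t j"

lemma power_sum2_eq: "power_sum2 (u + w) (u * w) j = u ^ j + w ^ j"
  by (induction "u + w" "u * w" j rule: power_sum2.induct) (auto simp: algebra_simps)

lemma (in comm_ring_hom) hom_power_sum2: "h (power_sum2 s t j) = power_sum2 (h s) (h t) j"
  by (induction s t j rule: power_sum2.induct) (auto simp: homs)

text \<open>
  In terms of the roots \<open>u\<close>, \<open>w\<close> above, this is \<open>z\<^sup>e (u\<^sup>k w\<^sup>l + u\<^sup>l w\<^sup>k)\<close>: the power sums are those of \<open>z u\<close>
  and \<open>z w\<close>, with sum \<open>- y\<close> and product \<open>x z\<close>.
\<close>

definition pair_term :: "'a::comm_ring_1 \<Rightarrow> 'a \<Rightarrow> 'a \<Rightarrow> nat \<Rightarrow> nat \<Rightarrow> nat \<Rightarrow> 'a" where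
  "pair_term x y z e k l =
     x ^ min k l * z ^ (e - max k l) * power_sum2 (- y) (x * z) (max k l - min k l)"

definition double_norm :: "'a::comm_ring_1 \<Rightarrow> 'a \<Rightarrow> 'a \<Rightarrow> nat \<Rightarrow> 'a poly \<Rightarrow> 'a" where
  "double_norm x y z e q = (\<Sum>k\<le>e. coeff q k * (\<Sum>l\<le>e. coeff q l * pair_term x y z e k l))"

lemma pair_term_Suc_Suc: "pair_term x y z (Suc e) (Suc k) (Suc l) = x * pair_term x y z e k l"
  by (simp add: pair_term_def mult_ac)

lemma pair_term_Suc: "k \<le> e \<Longrightarrow> l \<le> e \<Longrightarrow> pair_term x y z (Suc e) k l = z * pair_term x y z e k l"
  by (simp add: pair_term_def mult_ac Suc_diff_le)

lemma pair_term_commute: "pair_term x y z e k l = pair_term x y z e l k"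
  by (simp add: pair_term_def min.commute max.commute)

lemma pair_term_mixed_le:
  assumes "l \<le> k" "k \<le> e"
  shows "pair_term x y z (Suc e) (Suc k) l + pair_term x y z (Suc e) k (Suc l) = - y * pair_term x y z e k l"
proof (cases "k = l")
  case True
  then show ?thesis by (simp add: pair_term_def algebra_simps)
next
  case False
  with assms obtain j where k: "k = l + Suc j" using less_imp_Suc_add[of l k] by auto
  obtain i where e: "e = k + i" using assms le_Suc_ex by blast
  show ?thesis by (simp add: pair_term_def k e min_def max_def algebra_simps)
qed

lemma pair_term_mixed:
  assumes "k \<le> e" "l \<le> e"
  shows "pair_term x y z (Suc e) (Suc k) l + pair_term x y z (Suc e) k (Suc l) = - y * pair_term x y z e k l"
proof (cases "l \<le> k")
  case False
  then have "pair_term x y z (Suc e) (Suc l) k + pair_term x y z (Suc e) l (Suc k) = - y * pair_term x y z e l k"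
    using assms by (intro pair_term_mixed_le) auto
  then show ?thesis by (simp add: pair_term_commute[of x y z _ l] pair_term_commute[of x y z _ "Suc l"] add.commute)
qed (use pair_term_mixed_le assms in auto)

lemma sum_coeff_linear_mult:
  fixes q :: "'a::comm_ring_1 poly"
  assumes "degree q \<le> e"
  shows "(\<Sum>k\<le>Suc e. coeff ([:- a, 1:] * q) k * g k) = (\<Sum>k\<le>e. coeff q k * (g (Suc k) - a * g k))"
proof -
  have c: "coeff ([:- a, 1:] * q) k = (case k of 0 \<Rightarrow> 0 | Suc j \<Rightarrow> coeff q j) - a * coeff q k" for k
    by (simp add: coeff_pCons)
  have "(\<Sum>k\<le>Suc e. coeff ([:- a, 1:] * q) k * g k) =
     (\<Sum>k\<le>Suc e. (case k of 0 \<Rightarrow> 0 | Suc j \<Rightarrow> coeff q j) * g k) - (\<Sum>k\<le>Suc e. a * coeff q k * g k)"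
    unfolding c by (simp only: left_diff_distrib sum_subtractf)
  also have "(\<Sum>k\<le>Suc e. (case k of 0 \<Rightarrow> 0 | Suc j \<Rightarrow> coeff q j) * g k) = (\<Sum>k\<le>e. coeff q k * g (Suc k))"
    by (subst sum.atMost_Suc_shift) simp
  also have "(\<Sum>k\<le>Suc e. a * coeff q k * g k) = (\<Sum>k\<le>e. a * coeff q k * g k)"
    using assms by (simp add: coeff_eq_0)
  finally show ?thesis by (simp add: algebra_simps sum_subtractf)
qed

text \<open>
  Multiplying \<open>q\<close> by \<open>T - a\<close> multiplies \<open>q(u) q(w)\<close> by \<open>(u - a) (w - a)\<close>. The three rules for
  \<open>pair_term\<close> say how multiplication by \<open>u w\<close>, by 1 and by \<open>u + w\<close> acts once \<open>e\<close> is raised by one.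
\<close>

lemma double_norm_linear_mult:
  assumes "degree q \<le> e"
  shows "double_norm x y z (Suc e) ([:- a, 1:] * q) = (x + a * y + a ^ 2 * z) * double_norm x y z e q"
proof -
  let ?T = "pair_term x y z (Suc e)"
  have "double_norm x y z (Suc e) ([:- a, 1:] * q) =
    (\<Sum>k\<le>e. coeff q k * ((\<Sum>l\<le>e. coeff q l * (?T (Suc k) (Suc l) - a * ?T (Suc k) l)) -
       a * (\<Sum>l\<le>e. coeff q l * (?T k (Suc l) - a * ?T k l))))"
    unfolding double_norm_def sum_coeff_linear_mult[OF assms] ..
  also have "\<dots> = (\<Sum>k\<le>e. \<Sum>l\<le>e. coeff q k * coeff q l *
      (?T (Suc k) (Suc l) - a * (?T (Suc k) l + ?T k (Suc l)) + a ^ 2 * ?T k l))"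
    by (simp add: sum_distrib_left sum_subtractf[symmetric] right_diff_distrib power2_eq_square algebra_simps)
  also have "\<dots> = (\<Sum>k\<le>e. \<Sum>l\<le>e. coeff q k * coeff q l * ((x + a * y + a ^ 2 * z) * pair_term x y z e k l))"
  proof (intro sum.cong refl)
    fix k l assume "k \<in> {..e}" "l \<in> {..e}"
    hence kl: "k \<le> e" "l \<le> e" by auto
    show "coeff q k * coeff q l * (?T (Suc k) (Suc l) - a * (?T (Suc k) l + ?T k (Suc l)) + a ^ 2 * ?T k l) =
      coeff q k * coeff q l * ((x + a * y + a ^ 2 * z) * pair_term x y z e k l)"
      unfolding pair_term_mixed[OF kl] pair_term_Suc_Suc pair_term_Suc[OF kl] by (simp add: algebra_simps)
  qed
  also have "\<dots> = (x + a * y + a ^ 2 * z) * double_norm x y z e q"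
    by (simp add: double_norm_def sum_distrib_left mult_ac)
  finally show ?thesis .
qed

lemma double_norm_prod:
  "double_norm x y z d (\<Prod>i<d. [:- a i, 1:]) = 2 * (\<Prod>i<d. x + a i * y + a i ^ 2 * z)"
proof (induction d)
  case 0
  show ?case by (simp add: double_norm_def pair_term_def)
next
  case (Suc d)
  have "degree (\<Prod>i<d. [:- a i, 1:]) \<le> (\<Sum>i<d. degree [:- a i, 1:])"
    using degree_prod_sum_le[of "{..<d}" "\<lambda>i. [:- a i, 1:]"] by (simp add: o_def)
  also have "\<dots> \<le> (\<Sum>i<d. 1)" by (intro sum_mono) auto
  finally have "degree (\<Prod>i<d. [:- a i, 1:]) \<le> d" by simp
  note step = double_norm_linear_mult[OF this, of x y z "a d"]
  have "(\<Prod>i<Suc d. [:- a i, 1:]) = [:- a d, 1:] * (\<Prod>i<d. [:- a i, 1:])"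
    by (subst prod.lessThan_Suc) (rule mult.commute)
  hence "double_norm x y z (Suc d) (\<Prod>i<Suc d. [:- a i, 1:]) =
      (x + a d * y + a d ^ 2 * z) * (2 * (\<Prod>i<d. x + a i * y + a i ^ 2 * z))"
    by (simp only: step Suc.IH)
  thus ?case by (simp add: mult_ac)
qed

lemma double_norm_at_pair:
  assumes "degree q \<le> e"
  shows "double_norm (u * w) (- (u + w)) 1 e q = 2 * (poly q u * poly q w)"
proof -
  have T: "pair_term (u * w) (- (u + w)) 1 e k l = u ^ k * w ^ l + u ^ l * w ^ k" for k l
  proof -
    have "(u * w) ^ i * (u ^ j + w ^ j) = u ^ (i + j) * w ^ i + u ^ i * w ^ (i + j)" for i j
      by (simp add: power_add power_mult_distrib algebra_simps)
    from this[of "min k l" "max k l - min k l"] show ?thesis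
      by (cases "k \<le> l") (simp_all add: pair_term_def power_sum2_eq min_def max_def add.commute)
  qed
  have "double_norm (u * w) (- (u + w)) 1 e q =
     (\<Sum>k\<le>e. \<Sum>l\<le>e. (coeff q k * u ^ k) * (coeff q l * w ^ l)) +
     (\<Sum>k\<le>e. \<Sum>l\<le>e. (coeff q k * w ^ k) * (coeff q l * u ^ l))"
    unfolding double_norm_def T sum_distrib_left sum.distrib[symmetric]
    by (intro sum.cong refl) (simp add: algebra_simps)
  also have "\<dots> = poly q u * poly q w + poly q w * poly q u"
    by (simp add: poly_eq_sum_upto[OF assms] sum_product)
  finally show ?thesis by (simp add: algebra_simps)
qed

lemma (in comm_ring_hom) hom_double_norm:
  "h (double_norm x y z e q) = double_norm (h x) (h y) (h z) e (map_poly h q)"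
  by (simp add: double_norm_def pair_term_def homs hom_power_sum2 coeff_map_poly)

definition norm_form :: "rat poly \<Rightarrow> rat mpoly" where
  "norm_form p = const (1 / 2) * double_norm (var 0) (var 1) (var 2) (degree p) (map_poly const p)"

lemma comm_ring_hom_norm_form:
  fixes h :: "rat \<Rightarrow> 'b::comm_ring_1"
  assumes "comm_ring_hom G" "\<And>c. G (const c) = h c"
  shows "2 * G (norm_form p) = double_norm (G (var 0)) (G (var 1)) (G (var 2)) (degree p) (map_poly h p)"
proof -
  interpret G: comm_ring_hom G by fact
  have "2 * G (norm_form p) = G (2 * norm_form p)" by (simp add: G.homs)
  also have "2 * norm_form p = (2 * const (1 / 2)) * double_norm (var 0) (var 1) (var 2) (degree p) (map_poly const p)"
    unfolding norm_form_def by (simp only: mult.assoc)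
  also have "2 * const (1 / 2 :: rat) = 1"
    using mult_single[of 0 2 0 "1 / 2 :: rat"] by simp
  finally show ?thesis
    by (simp add: G.hom_double_norm G.hom_zero map_poly_map_poly o_def assms(2) del: One_nat_def)
qed

lemma power_sum2_in_subring:
  "is_subring A \<Longrightarrow> s \<in> A \<Longrightarrow> t \<in> A \<Longrightarrow> power_sum2 s t j \<in> A"
  by (induction s t j rule: power_sum2.induct) (auto intro: subring_intros)

lemma norm_form_in_polys:
  assumes "n \<ge> 2"
  shows "norm_form p \<in> polys n"
proof -
  note sub = is_subring_polys[of n]
  have v: "var 0 \<in> polys n" "var 1 \<in> polys n" "var 2 \<in> polys n"
    using assms by (auto intro: var_in_polys)
  show ?thesis
    unfolding norm_form_def double_norm_def pair_term_def
    by (intro subring_intros[OF sub] power_sum2_in_subring[OF sub] v)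
       (simp_all add: coeff_map_poly const_in_polys)
qed

text \<open>
  The lines \<open>x\<^sub>0 + u x\<^sub>1 + u\<^sup>2 x\<^sub>2 = 0\<close> and \<open>x\<^sub>0 + w x\<^sub>1 + w\<^sup>2 x\<^sub>2 = 0\<close> meet in this point; as tangents, they touch
  one conic. Further variables are set to zero.
\<close>

definition conic_point :: "'b::comm_ring_1 \<Rightarrow> 'b \<Rightarrow> nat \<Rightarrow> 'b" where
  "conic_point u w i = (if i = 0 then u * w else if i = 1 then - (u + w) else if i = 2 then 1 else 0)"

lemma (in comm_ring_hom) hom_conic_point: "h (conic_point u w i) = conic_point (h u) (h w) i"
  by (simp add: conic_point_def homs)

lemma norm_form_at_conic_point:
  fixes h :: "rat \<Rightarrow> 'b::{idom, ring_char_0}"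
  assumes "comm_ring_hom h"
  shows "mpoly_eval h (conic_point u w) (norm_form p) = poly (map_poly h p) u * poly (map_poly h p) w"
proof -
  interpret comm_ring_hom h by fact
  have "degree (map_poly h p) \<le> degree p" by (rule map_poly_degree_leq)
  hence "2 * mpoly_eval h (conic_point u w) (norm_form p) = 2 * (poly (map_poly h p) u * poly (map_poly h p) w)"
    unfolding comm_ring_hom_norm_form[OF comm_ring_hom_mpoly_eval mpoly_eval_const]
    by (simp add: mpoly_eval_var conic_point_def double_norm_at_pair del: minus_add_distrib)
  thus ?thesis by simp
qed

definition lin_form :: "'a::comm_ring_1 \<Rightarrow> 'a mpoly" where
  "lin_form a = var 0 + const a * var 1 + const a ^ 2 * var 2"

text \<open>
  The defining expression makes sense over every ring, so it can be compared with the product over the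
  splitting field.
\<close>

lemma norm_form_factorization:
  fixes a :: "nat \<Rightarrow> 'a::field_char_0"
  assumes "map_poly of_rat p = (\<Prod>i<degree p. [:- a i, 1:])"
  shows "base_change (norm_form p) = (\<Prod>i<degree p. lin_form (a i))"
proof -
  interpret bc: comm_ring_hom "base_change :: rat mpoly \<Rightarrow> 'a mpoly" by (rule comm_ring_hom_base_change)
  interpret c: comm_ring_hom "const :: 'a \<Rightarrow> 'a mpoly" by (rule comm_ring_hom_const)
  interpret mc: comm_ring_hom "map_poly const :: 'a poly \<Rightarrow> 'a mpoly poly" by (rule c.map_poly_comm_ring_hom)
  interpret r: comm_ring_hom "of_rat :: rat \<Rightarrow> 'a" by (rule comm_ring_hom_of_rat)
  have bv: "base_change (var i) = (var i :: 'a mpoly)" for i by (simp add: base_change_def r.map_var)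
  have bcc: "base_change (const c) = (const (of_rat c) :: 'a mpoly)" for c
    by (simp add: base_change_def)
  have "map_poly (\<lambda>c. const (of_rat c :: 'a)) p = map_poly const (map_poly of_rat p)"
    by (simp add: map_poly_map_poly o_def)
  also have "\<dots> = (\<Prod>i<degree p. [:- const (a i), 1:])"
    unfolding assms by (simp add: mc.hom_prod map_poly_pCons c.homs)
  finally have "2 * base_change (norm_form p) = 2 * (\<Prod>i<degree p. lin_form (a i))"
    unfolding comm_ring_hom_norm_form[OF comm_ring_hom_base_change bcc]
    by (simp add: bv double_norm_prod lin_form_def)
  thus ?thesis by simp
qed

section \<open>Properties of the norm form\<close>

lemma degree_pos_rat:
  assumes "irreducible (p :: rat poly)"
  shows "degree p > 0"
proof (rule ccontr)
  assume "\<not> degree p > 0"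
  hence "p dvd 1" using assms by (subst is_unit_iff_degree) auto
  thus False using assms by (simp add: irreducible_def)
qed

text \<open>
  At \<open>conic_point u 0\<close> the norm form becomes \<open>p(0) p(u)\<close>, so one of two factors becomes constant and
  the other has degree at least \<open>degree p\<close> in \<open>u\<close>, hence at least this total degree. The first factor then has total
  degree zero.
\<close>

lemma irreducible_norm_form:
  assumes irred: "irreducible p" and p0: "poly p 0 \<noteq> 0" and n: "n \<ge> 2"
    and form: "is_form (degree p) (norm_form p)"
  shows "irreducible_in (polys n) (norm_form p)"
proof -
  define d where "d = degree p"
  define x :: "nat \<Rightarrow> rat poly" where "x = conic_point [:0, 1:] 0"
  define \<epsilon> where "\<epsilon> = mpoly_eval (\<lambda>c. [:c:]) x"
  interpret e: comm_ring_hom \<epsilon>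
    unfolding \<epsilon>_def by (intro comm_ring_hom.comm_ring_hom_mpoly_eval comm_ring_hom_const_poly)
  interpret s: comm_ring_hom "scale_vars :: rat mpoly \<Rightarrow> _" by (rule comm_ring_hom_scale_vars)
  have "\<epsilon> (norm_form p) = poly (map_poly (\<lambda>c. [:c:]) p) [:0, 1:] * poly (map_poly (\<lambda>c. [:c:]) p) 0"
    unfolding \<epsilon>_def x_def by (intro norm_form_at_conic_point comm_ring_hom_const_poly)
  also have "poly (map_poly (\<lambda>c. [:c:]) p) [:0, 1:] = p"
    by (simp flip: pcompose_altdef)
  also have "poly (map_poly (\<lambda>c. [:c:]) p) 0 = [:poly p 0:]"
    by (simp flip: pcompose_altdef add: poly_0_coeff_0 coeff_map_poly)
  finally have ef: "\<epsilon> (norm_form p) = smult (poly p 0) p" by simp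
  have dpos: "d > 0" using degree_pos_rat[OF irred] by (simp add: d_def)
  have nz: "norm_form p \<noteq> 0" using ef p0 irred by (auto simp: e.homs irreducible_def)
  have not_unit: "\<not> unit_in (polys n) (norm_form p)"
  proof
    assume "unit_in (polys n) (norm_form p)"
    then obtain v where "norm_form p * v = 1" by (auto simp: unit_in_def)
    hence "\<epsilon> (norm_form p) * \<epsilon> v = 1" by (simp add: e.homs flip: e.hom_mult)
    hence "smult (poly p 0) p dvd 1" unfolding ef by (metis dvdI)
    hence "degree (smult (poly p 0) p) = 0" using p0 irred by (subst (asm) is_unit_iff_degree) auto
    thus False using dpos p0 by (simp add: d_def)
  qed
  have const_factor: "unit_in (polys n) a"
    if ab: "norm_form p = a * b" and a_dvd: "\<epsilon> a dvd 1" for a b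
  proof -
    have ab0: "a \<noteq> 0" "b \<noteq> 0" using ab nz by auto
    have "degree (scale_vars a) + degree (scale_vars b) = degree (scale_vars (norm_form p))"
      using ab0 by (simp add: ab s.hom_mult degree_mult_eq scale_vars_eq_0_iff)
    also have "\<dots> \<le> d" unfolding d_def by (intro degree_scale_vars_form form)
    finally have sum_le: "degree (scale_vars a) + degree (scale_vars b) \<le> d" .
    have eab: "\<epsilon> a * \<epsilon> b = smult (poly p 0) p" using ef by (simp add: ab e.hom_mult)
    hence e0: "\<epsilon> a \<noteq> 0" "\<epsilon> b \<noteq> 0" using p0 irred by auto
    have "degree (\<epsilon> a) = 0" using a_dvd e0 is_unit_iff_degree by blast
    hence "degree (\<epsilon> b) = d"
      using arg_cong[OF eab, of degree] p0 e0 by (simp add: degree_mult_eq d_def)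
    moreover have "degree (\<epsilon> b) \<le> degree (scale_vars b)"
      unfolding \<epsilon>_def by (rule degree_mpoly_eval_le) (auto simp: x_def conic_point_def)
    ultimately have "degree (scale_vars a) = 0" using sum_le by simp
    hence "m = 0" if "m \<in> Poly_Mapping.keys a" for m
      using mon_degree_le_scale_vars[OF that] by (simp add: mon_degree_eq_0)
    hence a: "a = const (Poly_Mapping.lookup a 0)"
      by (intro poly_mapping_eqI) (auto simp: lookup_single when_def in_keys_iff)
    define c where "c = Poly_Mapping.lookup a 0"
    have ac: "a = const c" using a by (simp add: c_def)
    with ab0 have "c \<noteq> 0" by auto
    thus ?thesis
      unfolding unit_in_def ac
      by (intro conjI bexI[of _ "const (inverse c)"]) (auto simp: const_in_polys mult_single)
  qed
  have "unit_in (polys n) a \<or> unit_in (polys n) b" if ab: "norm_form p = a * b" for a b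
  proof -
    have "p = smult (inverse (poly p 0)) (\<epsilon> a) * \<epsilon> b"
      using ef p0 by (simp add: ab e.hom_mult)
    hence "smult (inverse (poly p 0)) (\<epsilon> a) dvd 1 \<or> \<epsilon> b dvd 1" using irred irreducibleD by blast
    moreover have "\<epsilon> a dvd smult (inverse (poly p 0)) (\<epsilon> a)" by (rule dvd_smult) simp
    ultimately have "\<epsilon> a dvd 1 \<or> \<epsilon> b dvd 1" using dvd_trans by blast
    thus ?thesis using const_factor[OF ab] const_factor[of b a] ab by (auto simp: mult.commute)
  qed
  thus ?thesis using nz not_unit norm_form_in_polys[OF n] unfolding irreducible_in_def by blast
qed

lemma of_real_of_rat: "complex_of_real (of_rat c) = of_rat c"
  by (cases c) (simp add: of_rat_rat)

lemma degree_mono_ordered: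
  fixes A B :: "'a::linordered_idom poly"
  assumes "0 \<le> A" "A \<le> B"
  shows "degree A \<le> degree B"
proof (rule ccontr)
  assume deg: "\<not> degree A \<le> degree B"
  have "A \<noteq> 0" using deg by auto
  hence "lead_coeff A > 0" using assms(1) by (auto simp: less_eq_poly_def pos_poly_def)
  moreover have "degree (B - A) = degree A" "coeff (B - A) (degree A) = - lead_coeff A"
    using deg degree_add_eq_right[of B "- A"] by (auto simp: coeff_eq_0)
  moreover have "A \<noteq> B" using deg by auto
  hence "lead_coeff (B - A) > 0" using assms(2) by (auto simp: less_eq_poly_def pos_poly_def)
  ultimately show False by simp
qed

text \<open>
  At \<open>conic_point u w\<close> the summands become squares in \<open>\<rat>[u][w]\<close>, which is an ordered ring, so each is at most
  \<open>p(u) p(w)\<close> and \<open>degree_mono_ordered\<close> bounds the degrees in \<open>w\<close>. For conjugate \<open>u\<close> and \<open>w\<close> the point is real, so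
  if \<open>p(u) = 0\<close> all summands vanish there.
\<close>

lemma norm_form_not_sum_of_squares:
  assumes irred: "irreducible p" and deg: "degree p \<ge> 3" and monic: "lead_coeff p = 1"
    and a: "rat_eval a p = 0"
    and indep: "\<And>H :: rat poly poly. degree H < degree p - 1 \<Longrightarrow>
         poly (map_poly (rat_eval a) H) (cnj a) = 0 \<Longrightarrow> (\<forall>j. p dvd coeff H j)"
  shows "\<not> sum_of_squares_in R k (norm_form p)"
proof
  assume "sum_of_squares_in R k (norm_form p)"
  then obtain g where g: "norm_form p = (\<Sum>i<k. (g i)\<^sup>2)" by (auto simp: sum_of_squares_in_def)
  define h :: "rat \<Rightarrow> rat poly poly" where "h c = [:[:c:]:]" for c
  define x :: "nat \<Rightarrow> rat poly poly" where "x = conic_point [:[:0, 1:]:] [:0, 1:]"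
  define P where "P = smult p (map_poly (\<lambda>c. [:c:]) p)"
  have hom_h: "comm_ring_hom h"
    unfolding h_def[abs_def] by (intro comm_ring_hom_comp[OF comm_ring_hom_const_poly] comm_ring_hom_const_poly)
  interpret psi: comm_ring_hom "mpoly_eval h x"
    by (intro comm_ring_hom.comm_ring_hom_mpoly_eval hom_h)
  interpret cp: comm_ring_hom "\<lambda>c :: rat poly. [:c:]" by (rule comm_ring_hom_const_poly)
  define H where "H i = mpoly_eval h x (g i)" for i
  have mh: "map_poly h p = map_poly (\<lambda>c. [:c:]) (map_poly (\<lambda>c. [:c:]) p)"
    by (simp add: map_poly_map_poly o_def h_def[abs_def])
  have "poly (map_poly h p) [:[:0, 1:]:] = (\<Sum>i\<le>degree p. h (coeff p i) * [:[:0, 1:]:] ^ i)"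
    by (subst poly_eq_sum_upto[OF map_poly_degree_leq]) (auto simp: coeff_map_poly h_def)
  also have "\<dots> = [:\<Sum>i\<le>degree p. [:coeff p i:] * [:0, 1:] ^ i:]"
    by (simp only: cp.hom_sum cp.hom_mult cp.hom_power h_def)
  also have "(\<Sum>i\<le>degree p. [:coeff p i:] * [:0, 1:] ^ i) = poly (map_poly (\<lambda>c. [:c:]) p) [:0, 1:]"
    by (subst poly_eq_sum_upto[OF map_poly_degree_leq]) (auto simp: coeff_map_poly)
  also have "\<dots> = p" by (simp flip: pcompose_altdef)
  finally have pu: "poly (map_poly h p) [:[:0, 1:]:] = [:p:]" .
  have pw: "poly (map_poly h p) [:0, 1:] = map_poly (\<lambda>c. [:c:]) p"
    unfolding mh by (simp flip: pcompose_altdef)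
  have "mpoly_eval h x (norm_form p) = P"
    unfolding x_def norm_form_at_conic_point[OF hom_h] pu pw by (simp add: P_def)
  hence P: "P = (\<Sum>i<k. (H i)\<^sup>2)" by (simp add: g psi.homs H_def)
  have degP: "degree P \<le> degree p"
    unfolding P_def using map_poly_degree_leq[of "\<lambda>c. [:c:]" p] degree_smult_le le_trans by blast
  have degH: "degree (H i) < degree p - 1" if "i < k" for i
  proof -
    have "(H i)\<^sup>2 \<le> P" unfolding P using that by (intro member_le_sum) auto
    hence "degree ((H i)\<^sup>2) \<le> degree p"
      using degree_mono_ordered[of "(H i)\<^sup>2" P] degP by simp
    moreover have "degree ((H i)\<^sup>2) = 2 * degree (H i)"
      by (cases "H i = 0") (auto simp: power2_eq_square degree_mult_eq)
    ultimately show ?thesis using deg by linarith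
  qed
  define y :: "nat \<Rightarrow> real" where "y i = Re (conic_point a (cnj a) i)" for i
  have y: "complex_of_real (y i) = conic_point a (cnj a) i" for i
    by (auto simp: y_def conic_point_def complex_eq_iff)
  interpret ry: comm_ring_hom "mpoly_eval (of_rat :: rat \<Rightarrow> real) y"
    by (intro comm_ring_hom.comm_ring_hom_mpoly_eval comm_ring_hom_of_rat)
  interpret cr: comm_ring_hom complex_of_real by unfold_locales auto
  have real_val: "complex_of_real (mpoly_eval of_rat y q) = mpoly_eval of_rat (conic_point a (cnj a)) q" for q
    by (simp add: cr.hom_mpoly_eval y of_real_of_rat)
  define E where "E q = poly (map_poly (rat_eval a) q) (cnj a)" for q
  interpret E: comm_ring_hom E
    unfolding E_def[abs_def]
    by (intro comm_ring_hom_comp[OF comm_ring_hom_poly] comm_ring_hom.map_poly_comm_ring_hom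
          comm_ring_hom_rat_eval)
  have E_h: "E (h c) = of_rat c" for c by (simp add: E_def h_def map_poly_pCons)
  have E_x: "E (x i) = conic_point a (cnj a) i" for i
  proof -
    have "E [:[:0, 1:]:] = a" "E [:0, 1:] = cnj a" by (simp_all add: E_def map_poly_pCons)
    thus ?thesis by (simp only: x_def E.hom_conic_point)
  qed
  have "complex_of_real (\<Sum>i<k. (mpoly_eval of_rat y (g i))\<^sup>2) = complex_of_real (mpoly_eval of_rat y (norm_form p))"
    by (simp add: g ry.homs)
  also have "\<dots> = 0"
    unfolding real_val norm_form_at_conic_point[OF comm_ring_hom_of_rat] by (simp add: a)
  finally have "(\<Sum>i<k. (mpoly_eval of_rat y (g i))\<^sup>2) = 0" by (simp only: of_real_eq_0_iff)
  hence "mpoly_eval of_rat y (g i) = 0" if "i < k" for i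
    using that by (subst (asm) sum_nonneg_eq_0_iff) auto
  hence "E (H i) = 0" if "i < k" for i
    using that real_val[of "g i"] by (simp add: H_def E.hom_mpoly_eval E_h E_x)
  hence "\<forall>j. p dvd coeff (H i) j" if "i < k" for i
    using that by (intro indep degH) (auto simp: E_def)
  hence "[:p:] dvd H i" if "i < k" for i using that by (simp add: const_poly_dvd_iff)
  \<comment> \<open>The coefficient of \<open>P\<close> at the highest power of \<open>w\<close> is \<open>p\<close>, which \<open>p\<^sup>2\<close> cannot divide.\<close>
  hence "[:p:]\<^sup>2 dvd P" unfolding P by (intro dvd_sum dvd_power_same) auto
  moreover have "[:p:]\<^sup>2 = [:p\<^sup>2:]" by (simp add: power2_eq_square)
  ultimately have "p\<^sup>2 dvd coeff P (degree p)" by (simp add: const_poly_dvd_iff)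
  also have "coeff P (degree p) = p" using monic by (simp add: P_def coeff_map_poly)
  finally have "p * p dvd p * 1" by (simp add: power2_eq_square)
  moreover have "p \<noteq> 0" using irred by auto
  ultimately have "p dvd 1" by (subst (asm) dvd_mult_cancel_left) auto
  thus False using irred by (simp add: irreducible_def)
qed

text \<open>With \<open>g = r + \<i> s\<close> the product of one form from each conjugate pair, \<open>g * cnj g = r\<^sup>2 + s\<^sup>2\<close>.\<close>

lemma sum_of_two_squares_of_conjugate_product:
  fixes G :: "complex mpoly"
  assumes G: "G \<in> polys n"
    and f: "base_change f = G * Poly_Mapping.map cnj G"
  shows "sum_of_squares_in (polys n) 2 (base_change f :: real mpoly)"
proof -
  define A where "A = Poly_Mapping.map Re G"
  define B where "B = Poly_Mapping.map Im G"
  let ?E = "Poly_Mapping.map complex_of_real"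
  interpret cr: comm_ring_hom complex_of_real by unfold_locales auto
  interpret E: comm_ring_hom "?E :: real mpoly \<Rightarrow> complex mpoly" by (rule cr.comm_ring_hom_map)
  interpret c: comm_ring_hom "const :: complex \<Rightarrow> complex mpoly" by (rule comm_ring_hom_const)
  have lookup_const: "Poly_Mapping.lookup (const c * p) m = c * Poly_Mapping.lookup p m"
    for c and p :: "complex mpoly" and m
    by (simp add: map.rep_eq when_def flip: mult_map_scale_conv_mult)
  define C where "C = Poly_Mapping.map cnj G"
  have GC: "G = ?E A + const \<i> * ?E B" "C = ?E A - const \<i> * ?E B"
    by (intro poly_mapping_eqI; simp add: A_def B_def C_def lookup_add lookup_minus lookup_const map.rep_eq
        when_def complex_eq_iff)+
  have "base_change f = G * C" using f by (simp add: C_def)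
  also have "\<dots> = (?E A + const \<i> * ?E B) * (?E A - const \<i> * ?E B)" by (simp only: GC)
  also have "\<dots> = (?E A)\<^sup>2 - (const \<i> * const \<i>) * (?E B)\<^sup>2"
    by (simp add: power2_eq_square algebra_simps)
  also have "const \<i> * const \<i> = - (1 :: complex mpoly)" by (simp add: c.homs flip: c.hom_mult)
  finally have "base_change f = ?E (A\<^sup>2 + B\<^sup>2)" by (simp add: E.homs)
  moreover have "base_change f = ?E (base_change f)"
    by (intro poly_mapping_eqI) (simp add: lookup_base_change map.rep_eq when_def of_real_of_rat)
  moreover have "p = q" if "?E p = ?E q" for p q :: "real mpoly"
  proof (rule poly_mapping_eqI)
    fix m
    have "Poly_Mapping.lookup (?E p) m = Poly_Mapping.lookup (?E q) m" by (simp only: that)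
    thus "Poly_Mapping.lookup p m = Poly_Mapping.lookup q m"
      by (simp add: map.rep_eq when_def split: if_splits)
  qed
  ultimately have "base_change f = A\<^sup>2 + B\<^sup>2" by metis
  moreover have "A \<in> polys n" "B \<in> polys n" using G by (auto simp: A_def B_def intro: map_in_polys)
  ultimately show ?thesis
    unfolding sum_of_squares_in_def
    by (intro exI[of _ "\<lambda>i. if i = 0 then A else B"]) (auto simp: numeral_2_eq_2)
qed

text \<open>
  Irreducibility makes the roots simple, so the set of roots can be split by the sign of the imaginary part.
\<close>

lemma conjugate_root_pairs:
  assumes "d \<ge> 4" "even d"
  obtains z where "(base_poly d :: complex poly) = (\<Prod>i<d div 2. [:- z i, 1:] * [:- cnj (z i), 1:])"
proof -
  define p where "p = (base_poly d :: complex poly)"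
  define r where "r = (base_poly d :: rat poly)"
  have pr: "p = map_poly of_rat r" by (simp add: p_def r_def map_base_poly)
  have dp: "degree p = d" "lead_coeff p = 1" and dr: "degree r = d"
    using assms by (simp_all add: p_def r_def degree_base_poly lead_coeff_base_poly)
  have irred: "irreducible r" unfolding r_def using assms by (rule irreducible_base_poly)
  have "rsquarefree p"
    unfolding rsquarefree_roots
  proof (intro allI notI, elim conjE)
    fix z assume z: "poly p z = 0" "poly (pderiv p) z = 0"
    interpret ev: comm_ring_hom "rat_eval z" by (rule comm_ring_hom_rat_eval)
    have pd: "map_poly of_rat (pderiv r) = pderiv p"
      unfolding pr by (intro poly_eqI) (simp add: coeff_pderiv coeff_map_poly of_rat_mult of_rat_add)
    have "pderiv r \<noteq> 0" using dr assms by (simp add: pderiv_eq_0_iff)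
    hence "\<not> r dvd pderiv r"
      using dvd_imp_degree_le[of r "pderiv r"] degree_pderiv[of r] dr assms by auto
    hence "coprime r (pderiv r)"
      using irred by (simp add: prime_elem_imp_coprime irreducible_imp_prime_elem)
    then obtain s t where "s * r + t * pderiv r = 1"
      using bezout_coefficients_fst_snd[of r "pderiv r"] by auto
    hence "rat_eval z (s * r + t * pderiv r) = 1" by (simp add: ev.homs)
    thus False using z by (simp add: ev.homs pd flip: pr)
  qed
  hence prod: "p = (\<Prod>z | poly p z = 0. [:- z, 1:])"
    using complex_poly_decompose_rsquarefree[of p] dp by simp
  define U where "U = {z. poly p z = 0 \<and> Im z > 0}"
  have p0: "p \<noteq> 0" using dp assms by auto
  have finU: "finite U" using poly_roots_finite[OF p0] by (rule rev_finite_subset) (auto simp: U_def)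
  have cnj_root: "poly p (cnj z) = 0 \<longleftrightarrow> poly p z = 0" for z
  proof -
    have "poly p (cnj z) = cnj (poly p z)" by (simp add: p_def poly_base_poly)
    thus ?thesis by simp
  qed
  have Im_nz: "Im z \<noteq> 0" if "poly p z = 0" for z
  proof
    assume "Im z = 0"
    hence "z = complex_of_real (Re z)" by (simp add: complex_eq_iff)
    moreover have "poly p (complex_of_real (Re z)) = complex_of_real (poly (base_poly d) (Re z))"
      by (simp add: p_def poly_base_poly)
    ultimately show False using that base_poly_pos[of d "Re z"] assms by simp
  qed
  have "{z. poly p z = 0} = U \<union> cnj ` U"
  proof (intro set_eqI iffI)
    fix z assume z: "z \<in> {z. poly p z = 0}"
    show "z \<in> U \<union> cnj ` U"
    proof (cases "Im z > 0")
      case False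
      hence "cnj z \<in> U" using z Im_nz[of z] by (simp add: U_def cnj_root)
      thus ?thesis by (metis UnI2 complex_cnj_cnj imageI)
    qed (use z in \<open>auto simp: U_def\<close>)
  qed (auto simp: U_def cnj_root)
  moreover have "U \<inter> cnj ` U = {}" by (auto simp: U_def)
  ultimately have "p = (\<Prod>z\<in>U. [:- z, 1:]) * (\<Prod>z\<in>cnj ` U. [:- z, 1:])"
    using finU prod by (simp add: prod.union_disjoint)
  also have "(\<Prod>z\<in>cnj ` U. [:- z, 1:]) = (\<Prod>z\<in>U. [:- cnj z, 1:])"
    by (subst prod.reindex) (auto simp: inj_on_def)
  finally have pU: "p = (\<Prod>z\<in>U. [:- z, 1:] * [:- cnj z, 1:])" by (simp only: prod.distrib)
  have "d = degree (\<Prod>z\<in>U. [:- z, 1:] * [:- cnj z, 1:])" using dp pU by simp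
  also have "\<dots> = (\<Sum>z\<in>U. degree ([:- z, 1:] * [:- cnj z, 1:]))"
    by (intro degree_prod_eq_sum_degree) auto
  also have "\<dots> = 2 * card U" by simp
  finally have card: "d div 2 = card U" by simp
  obtain z where z: "bij_betw z {0..<card U} U" using ex_bij_betw_nat_finite[OF finU] by blast
  have "p = (\<Prod>i\<in>{0..<card U}. [:- z i, 1:] * [:- cnj (z i), 1:])"
    unfolding pU using prod.reindex_bij_betw[OF z, of "\<lambda>z. [:- z, 1:] * [:- cnj z, 1:]"] by simp
  thus ?thesis using that[of z] by (simp add: p_def card atLeast0LessThan)
qed

lemma prod_pairs: "(\<Prod>i<2 * m. F i) = (\<Prod>i<m. F (2 * i) * F (Suc (2 * i)))"
  for F :: "nat \<Rightarrow> 'a::comm_monoid_mult"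
  by (induction m) (simp_all add: mult_ac)

lemma lin_form_in_polys: "n \<ge> 2 \<Longrightarrow> lin_form a \<in> polys n"
  unfolding lin_form_def
  by (intro subring_intros[OF is_subring_polys] const_in_polys var_in_polys) auto

lemma is_form_lin_form: "is_form 1 (lin_form a)"
proof -
  have "is_form 1 (const c * var i :: 'a mpoly)" for c i
    using is_form_mult[OF is_form_const is_form_var, of c i] by simp
  moreover have "const a ^ 2 = const (a ^ 2)"
    by (simp add: power2_eq_square mult_single)
  ultimately show ?thesis
    unfolding lin_form_def by (simp only: is_form_add is_form_var)
qed

lemma map_cnj_lin_form: "Poly_Mapping.map cnj (lin_form a) = lin_form (cnj a)"
proof -
  interpret c: comm_ring_hom cnj by unfold_locales auto
  interpret m: comm_ring_hom "Poly_Mapping.map cnj :: complex mpoly \<Rightarrow> complex mpoly"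
    by (rule c.comm_ring_hom_map)
  show ?thesis by (simp add: lin_form_def m.homs c.map_var)
qed

theorem theorem2p1:
  fixes n d :: nat
  assumes "n \<ge> 2" and "d \<ge> 4" and "even d"
  shows "\<exists>f \<in> (polys n :: rat mpoly set). is_form d f \<and>
    irreducible_in (polys n) f \<and>
    (\<exists>l :: nat \<Rightarrow> complex mpoly.
       (\<forall>i<d. l i \<in> polys n \<and> is_form 1 (l i)) \<and> base_change f = (\<Prod>i<d. l i)) \<and>
    sum_of_squares_in (polys n) 2 (base_change f :: real mpoly) \<and>
    (\<forall>k. \<not> sum_of_squares_in (polys n) k f)"
proof -
  define p :: "rat poly" where "p = base_poly d"
  define f where "f = norm_form p"
  have deg: "degree p = d" and monic: "lead_coeff p = 1"
    using assms by (simp_all add: p_def degree_base_poly lead_coeff_base_poly)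
  have irred: "irreducible p" unfolding p_def using assms by (intro irreducible_base_poly)
  obtain z where z: "(base_poly d :: complex poly) = (\<Prod>i<d div 2. [:- z i, 1:] * [:- cnj (z i), 1:])"
    using conjugate_root_pairs assms by blast
  define a where "a i = (if even i then z (i div 2) else cnj (z (i div 2)))" for i
  define l where "l i = lin_form (a i)" for i
  have d2: "d = 2 * (d div 2)" using assms by simp
  have "map_poly of_rat p = (\<Prod>i<d. [:- a i, 1:])"
    unfolding p_def map_base_poly z by (subst d2, subst prod_pairs) (simp add: a_def)
  hence fact: "base_change f = (\<Prod>i<d. l i)"
    using norm_form_factorization[of p a] by (simp add: f_def l_def deg)
  have l: "l i \<in> polys n" "is_form 1 (l i)" for i
    using assms lin_form_in_polys is_form_lin_form by (auto simp: l_def)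
  have "is_form d (base_change f :: complex mpoly)" unfolding fact by (intro is_form_prod l)
  hence form: "is_form d f" by (simp add: is_form_def in_keys_iff lookup_base_change)
  have "irreducible_in (polys n) f"
    unfolding f_def
  proof (rule irreducible_norm_form[OF irred _ assms(1)])
    show "poly p 0 \<noteq> 0" using assms by (simp add: p_def poly_base_poly power_0_left)
    show "is_form (degree p) (norm_form p)" using form by (simp add: deg f_def)
  qed
  moreover have "sum_of_squares_in (polys n) 2 (base_change f :: real mpoly)"
  proof (rule sum_of_two_squares_of_conjugate_product)
    define G where "G = (\<Prod>i<d div 2. lin_form (z i))"
    show "G \<in> polys n"
      unfolding G_def using assms by (intro subring_prod[OF is_subring_polys] lin_form_in_polys)
    interpret c: comm_ring_hom cnj by unfold_locales auto
    interpret m: comm_ring_hom "Poly_Mapping.map cnj :: complex mpoly \<Rightarrow> complex mpoly"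
      by (rule c.comm_ring_hom_map)
    have "base_change f = (\<Prod>i<d div 2. lin_form (z i) * lin_form (cnj (z i)))"
      unfolding fact by (subst d2, subst prod_pairs) (simp add: l_def a_def)
    thus "base_change f = G * Poly_Mapping.map cnj G"
      by (simp add: G_def m.hom_prod map_cnj_lin_form prod.distrib)
  qed
  moreover have "\<not> sum_of_squares_in (polys n) k f" for k
  proof -
    obtain b where b: "poly (base_poly d) b = 0"
      "\<And>H :: rat poly poly. degree H < d - 1 \<Longrightarrow>
         poly (map_poly (rat_eval b) H) (cnj b) = 0 \<Longrightarrow> (\<forall>j. base_poly d dvd coeff H j)"
      using conjugate_root_independent[of d] assms by blast
    show ?thesis
      unfolding f_def
      by (rule norm_form_not_sum_of_squares[OF irred _ monic, of b])
         (use b assms in \<open>auto simp: deg p_def map_base_poly degree_base_poly\<close>)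
  qed
  moreover have "f \<in> polys n" unfolding f_def using assms by (intro norm_form_in_polys)
  ultimately show ?thesis using form fact l by blast
qed

end
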